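(* Let $\tilde w_1,\dots,\tilde w_r\in\tilde W$ lie in pairwise distinct conjugacy classes of $\tilde W$. Then the images of $T_{\tilde w_1},\dots,T_{\tilde w_r}$ in $\tilde H_{\mathbb C}/[\tilde H_{\mathbb C},\tilde H_{\mathbb C}]$ are linearly independent over $\mathbb C[v,v^{-1}]$.
   Context: Setting: $W=Q\rtimes W_0$ affine Weyl group with simple reflections $S$; $\tilde W=P\rtimes(W_0\rtimes\Omega')=W\rtimes\Omega$ for a connected complex reductive group with coweight lattice $P$ and finite group $\Omega'$ of diagram automorphisms; $\ell$ the length on $\tilde W$. $\mathcal A=\mathbb Z[v,v^{-1}]$; $\tilde H$ is the $\mathcal A$-algebra with basis $\{T_w\}_{w\in\tilde W}$, $T_xT_y=T_{xy}$ when $\ell(xy)=\ell(x)+\ell(y)$, and $(T_s-v)(T_s+v^{-1})=0$ for $s\in S$. $\tilde H_{\mathbb C}=\tilde H\otimes_{\mathcal A}\mathbb C[v,v^{-1}]$ and $[\tilde H_{\mathbb C},\tilde H_{\mathbb C}]$ is the $\mathbb C[v,v^{-1}]$-span of commutators. *)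

theory Defs
  imports "HOL-Analysis.Finite_Cartesian_Product" "HOL-Library.Poly_Mapping"
begin

text \<open>The coweight (cocharacter) lattice P is modelled as int^'n, the character
lattice X as int^'n as well, with the standard perfect pairing.\<close>

definition pairing :: "int^'n \<Rightarrow> int^'n \<Rightarrow> int" where
  "pairing x a = (\<Sum>i\<in>UNIV. x$i * a$i)"

definition rpairing :: "real^'n \<Rightarrow> int^'n \<Rightarrow> real" where
  "rpairing f a = (\<Sum>i\<in>UNIV. f$i * of_int (a$i))"

text \<open>Root datum (Phi in X, coroot map cor : Phi -> P), Springer's axioms.\<close>
definition root_datum :: "(int^'n) set \<Rightarrow> (int^'n \<Rightarrow> int^'n) \<Rightarrow> bool" where
  "root_datum Phi cor \<longleftrightarrow>
     finite Phi \<and> inj_on cor Phi \<and>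
     (\<forall>a\<in>Phi. pairing (cor a) a = 2) \<and>
     (\<forall>a\<in>Phi. \<forall>b\<in>Phi. b - (pairing (cor a) b) *s a \<in> Phi) \<and>
     (\<forall>a\<in>Phi. \<forall>b\<in>Phi. cor b - (pairing (cor b) a) *s cor a \<in> cor ` Phi)"

text \<open>Root data of connected reductive groups are reduced.\<close>
definition reduced_rd :: "(int^'n) set \<Rightarrow> bool" where
  "reduced_rd Phi \<longleftrightarrow> (\<forall>a\<in>Phi. 2 *s a \<notin> Phi)"

definition positive_system :: "(int^'n) set \<Rightarrow> (int^'n) set \<Rightarrow> bool" where
  "positive_system Phi pos \<longleftrightarrow>
     (\<exists>f::real^'n. (\<forall>a\<in>Phi. rpairing f a \<noteq> 0) \<and> pos = {a\<in>Phi. rpairing f a > 0})"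

text \<open>Reflection s_a acting on P: x |-> x - <x,a> a^vee, as an integer matrix.\<close>
definition refl_mat :: "(int^'n \<Rightarrow> int^'n) \<Rightarrow> int^'n \<Rightarrow> int^'n^'n" where
  "refl_mat cor a = (\<chi> i j. (if i = j then 1 else 0) - (cor a)$i * a$j)"

inductive_set weyl0 :: "(int^'n) set \<Rightarrow> (int^'n \<Rightarrow> int^'n) \<Rightarrow> (int^'n^'n) set"
  for Phi cor where
  one: "mat 1 \<in> weyl0 Phi cor"
| refl: "a \<in> Phi \<Longrightarrow> M \<in> weyl0 Phi cor \<Longrightarrow> refl_mat cor a ** M \<in> weyl0 Phi cor"

inductive_set coroot_lattice :: "(int^'n) set \<Rightarrow> (int^'n \<Rightarrow> int^'n) \<Rightarrow> (int^'n) set"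
  for Phi cor where
  zero: "0 \<in> coroot_lattice Phi cor"
| add: "a \<in> Phi \<Longrightarrow> x \<in> coroot_lattice Phi cor \<Longrightarrow> x + cor a \<in> coroot_lattice Phi cor"
| sub: "a \<in> Phi \<Longrightarrow> x \<in> coroot_lattice Phi cor \<Longrightarrow> x - cor a \<in> coroot_lattice Phi cor"

text \<open>Diagram automorphism: a Z-linear automorphism phi of P which is an automorphism
of the based root datum: the induced map phi_* on X (characterised by
transpose phi *v (phi_* a) = a) maps roots to roots, is compatible with coroots
and preserves positive roots.\<close>
definition diagram_aut :: "(int^'n) set \<Rightarrow> (int^'n \<Rightarrow> int^'n) \<Rightarrow> (int^'n) set \<Rightarrow> int^'n^'n \<Rightarrow> bool" where
  "diagram_aut Phi cor pos phi \<longleftrightarrow>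
     (\<forall>a\<in>Phi. \<exists>b\<in>Phi. transpose phi *v b = a \<and> phi *v cor a = cor b \<and> (a \<in> pos \<longrightarrow> b \<in> pos))"

definition diagram_group :: "(int^'n) set \<Rightarrow> (int^'n \<Rightarrow> int^'n) \<Rightarrow> (int^'n) set \<Rightarrow> (int^'n^'n) set \<Rightarrow> bool" where
  "diagram_group Phi cor pos Om \<longleftrightarrow>
     finite Om \<and> mat 1 \<in> Om \<and> (\<forall>p\<in>Om. \<forall>q\<in>Om. p ** q \<in> Om) \<and>
     (\<forall>p\<in>Om. \<exists>q\<in>Om. p ** q = mat 1) \<and> (\<forall>p\<in>Om. diagram_aut Phi cor pos p)"

text \<open>An element (lambda, M) is the affine map x |-> lambda + M x of P, i.e. t^lambda M.\<close>
type_synonym 'n ewg = "(int^'n) \<times> (int^'n^'n)"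

definition ew_mult :: "('n::finite) ewg \<Rightarrow> 'n ewg \<Rightarrow> 'n ewg" where
  "ew_mult x y = (fst x + snd x *v fst y, snd x ** snd y)"

definition ew_one :: "('n::finite) ewg" where
  "ew_one = (0, mat 1)"

definition ext_weyl :: "(int^('n::finite)) set \<Rightarrow> (int^'n \<Rightarrow> int^'n) \<Rightarrow> (int^'n^'n) set \<Rightarrow> 'n ewg set" where
  "ext_weyl Phi cor Om = {(l, w ** p) | l w p. w \<in> weyl0 Phi cor \<and> p \<in> Om}"

definition aff_weyl :: "(int^('n::finite)) set \<Rightarrow> (int^'n \<Rightarrow> int^'n) \<Rightarrow> 'n ewg set" where
  "aff_weyl Phi cor = {(l, w) | l w. l \<in> coroot_lattice Phi cor \<and> w \<in> weyl0 Phi cor}"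

text \<open>Length (Iwahori--Matsumoto formula = number of affine root hyperplanes
separating the fundamental alcove {0 < <x,a> < 1, a > 0} from its image):
l(t^lambda u) = sum over a > 0 of |<lambda,a>| if u^{-1} a > 0, |<lambda,a> - 1| otherwise.\<close>
definition ew_len :: "(int^('n::finite)) set \<Rightarrow> 'n ewg \<Rightarrow> nat" where
  "ew_len pos x = nat (\<Sum>a\<in>pos. if transpose (snd x) *v a \<in> pos
                                  then \<bar>pairing (fst x) a\<bar>
                                  else \<bar>pairing (fst x) a - 1\<bar>)"

definition simple_refls :: "(int^('n::finite)) set \<Rightarrow> (int^'n \<Rightarrow> int^'n) \<Rightarrow> (int^'n) set \<Rightarrow> 'n ewg set" where
  "simple_refls Phi cor pos = {s \<in> aff_weyl Phi cor. ew_len pos s = 1}"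

definition conj_in :: "('n::finite) ewg set \<Rightarrow> 'n ewg \<Rightarrow> 'n ewg \<Rightarrow> bool" where
  "conj_in G x y \<longleftrightarrow> (\<exists>g\<in>G. ew_mult g x = ew_mult y g)"

text \<open>C[v,v^-1] as the group algebra C[Z].\<close>
type_synonym lpoly = "int \<Rightarrow>\<^sub>0 complex"

definition lv :: lpoly where "lv = Poly_Mapping.single 1 1"
definition lvinv :: lpoly where "lvinv = Poly_Mapping.single (-1) 1"

definition hsmult :: "lpoly \<Rightarrow> ('w \<Rightarrow>\<^sub>0 lpoly) \<Rightarrow> ('w \<Rightarrow>\<^sub>0 lpoly)" where
  "hsmult c h = Poly_Mapping.map (\<lambda>a. c * a) h"

definition Tb :: "'w \<Rightarrow> ('w \<Rightarrow>\<^sub>0 lpoly)" where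
  "Tb w = Poly_Mapping.single w 1"

definition hcarrier :: "'w set \<Rightarrow> ('w \<Rightarrow>\<^sub>0 lpoly) set" where
  "hcarrier G = {h. Poly_Mapping.keys h \<subseteq> G}"

text \<open>m is a multiplication making the free module with basis T_w (w in G) into the
Hecke algebra: an associative C[v,v^-1]-bilinear product with
T_x T_y = T_{xy} when l(xy) = l(x) + l(y), and (T_s - v)(T_s + v^-1) = 0 for s in S.
These properties determine m uniquely.\<close>
definition is_hecke_mult :: "'w set \<Rightarrow> ('w \<Rightarrow> 'w \<Rightarrow> 'w) \<Rightarrow> 'w \<Rightarrow> ('w \<Rightarrow> nat) \<Rightarrow> 'w set
     \<Rightarrow> (('w \<Rightarrow>\<^sub>0 lpoly) \<Rightarrow> ('w \<Rightarrow>\<^sub>0 lpoly) \<Rightarrow> ('w \<Rightarrow>\<^sub>0 lpoly)) \<Rightarrow> bool" where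
  "is_hecke_mult G gmul e len S m \<longleftrightarrow>
     (\<forall>x\<in>hcarrier G. \<forall>y\<in>hcarrier G. m x y \<in> hcarrier G) \<and>
     (\<forall>x\<in>hcarrier G. \<forall>y\<in>hcarrier G. \<forall>z\<in>hcarrier G.
        m (x + y) z = m x z + m y z \<and> m x (y + z) = m x y + m x z \<and>
        m (m x y) z = m x (m y z)) \<and>
     (\<forall>c. \<forall>x\<in>hcarrier G. \<forall>y\<in>hcarrier G.
        m (hsmult c x) y = hsmult c (m x y) \<and> m x (hsmult c y) = hsmult c (m x y)) \<and>
     (\<forall>x\<in>G. \<forall>y\<in>G. len (gmul x y) = len x + len y \<longrightarrow> m (Tb x) (Tb y) = Tb (gmul x y)) \<and>
     (\<forall>s\<in>S. m (Tb s - hsmult lv (Tb e)) (Tb s + hsmult lvinv (Tb e)) = 0)"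

inductive_set comm_span :: "'w set \<Rightarrow> (('w \<Rightarrow>\<^sub>0 lpoly) \<Rightarrow> ('w \<Rightarrow>\<^sub>0 lpoly) \<Rightarrow> ('w \<Rightarrow>\<^sub>0 lpoly))
     \<Rightarrow> ('w \<Rightarrow>\<^sub>0 lpoly) set" for G m where
  zero: "0 \<in> comm_span G m"
| step: "u \<in> comm_span G m \<Longrightarrow> x \<in> hcarrier G \<Longrightarrow> y \<in> hcarrier G \<Longrightarrow>
         u + hsmult c (m x y - m y x) \<in> comm_span G m"

end

theory Submission
  imports Defs "HOL-Algebra.Group" "HOL-Combinatorics.Cycles"
begin

text \<open>
  At \<open>v = 1\<close> the Hecke algebra \<open>H\<close> becomes the group algebra of \<open>G\<close>, in whose cocenter distinct
  conjugacy classes are independent. Hence it suffices that \<open>H/[H,H]\<close> has no \<open>(v - 1)\<close>-torsion: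
  a relation between the \<open>T\<^sub>w\<close> can then be divided by \<open>v - 1\<close> until it does not vanish at \<open>v = 1\<close>.

  Put \<open>F(g,x) = [T\<^sub>g, T\<^sub>h]\<close> where \<open>gh = x\<close>. Modulo \<open>(v - 1)[H,H]\<close> it is a cocycle on the action
  groupoid of conjugation, \<open>F(gh,x) = F(g,x) + F(h,x')\<close> with \<open>x'\<close> the conjugate of \<open>x\<close> by \<open>g\<close>. If
  \<open>F(g,x)\<close> vanishes whenever \<open>g\<close> and \<open>x\<close> commute, then \<open>F(g,x) = p(x) - p(x')\<close> for some \<open>p\<close>, and the
  linear extension \<open>P\<close> of \<open>p\<close> satisfies \<open>z = P(z)\<close> modulo \<open>(v - 1)[H,H]\<close> for all \<open>z\<close> in \<open>[H,H]\<close>; so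
  \<open>z \<in> (v - 1)H\<close> forces \<open>z \<in> (v - 1)[H,H]\<close>.

  For commuting \<open>g\<close>, \<open>x\<close> the map \<open>F(\<cdot>,x)\<close> is additive on powers of \<open>g\<close>, so \<open>g\<close> may be replaced by a
  power whose linear part fixes all roots. By the Iwahori--Matsumoto formula the length is then
  additive on the product of \<open>g\<close> with \<open>z = g\<^sup>jx\<close> for large \<open>j\<close>. Thus \<open>T\<^sub>g\<close> commutes with \<open>T\<^sub>z\<close>, and a negative
  power of \<open>T\<^sub>g\<close> times \<open>T\<^sub>z\<close> lifts the second entry of the commutator to an element commuting with \<open>T\<^sub>g\<close>.
\<close>

section \<open>Free modules over Laurent polynomials\<close>

lemma lookup_hsmult [simp]: "Poly_Mapping.lookup (hsmult c h) x = c * Poly_Mapping.lookup h x"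
  by (simp add: hsmult_def Poly_Mapping.map.rep_eq when_def)

interpretation hs: module "hsmult :: lpoly \<Rightarrow> ('w \<Rightarrow>\<^sub>0 lpoly) \<Rightarrow> _"
  by unfold_locales (auto intro!: poly_mapping_eqI simp: lookup_add algebra_simps)

lemma lookup_Tb: "Poly_Mapping.lookup (Tb w) x = (if w = x then 1 else 0)"
  by (simp add: Tb_def lookup_single when_def)

lemma hcarrier_iff: "h \<in> hcarrier X \<longleftrightarrow> (\<forall>x. x \<notin> X \<longrightarrow> Poly_Mapping.lookup h x = 0)"
  by (auto simp: hcarrier_def in_keys_iff)

lemma Tb_in_hcarrier [simp]: "Tb x \<in> hcarrier X \<longleftrightarrow> x \<in> X"
  by (auto simp: hcarrier_iff lookup_Tb split: if_splits)

lemma subspace_hcarrier: "hs.subspace (hcarrier X)"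
  by (auto simp: hs.subspace_def hcarrier_iff lookup_add)

lemma sum_lookup_Tb: "h = (\<Sum>x\<in>Poly_Mapping.keys h. hsmult (Poly_Mapping.lookup h x) (Tb x))"
proof (rule poly_mapping_eqI)
  fix k
  have "(\<Sum>x\<in>Poly_Mapping.keys h. Poly_Mapping.lookup h x * (if x = k then 1 else 0))
      = (\<Sum>x\<in>Poly_Mapping.keys h. if x = k then Poly_Mapping.lookup h x else 0)"
    by (rule sum.cong) auto
  also have "\<dots> = Poly_Mapping.lookup h k"
    by (simp add: in_keys_iff)
  finally show "Poly_Mapping.lookup h k = Poly_Mapping.lookup (\<Sum>x\<in>Poly_Mapping.keys h. hsmult (Poly_Mapping.lookup h x) (Tb x)) k"
    by (simp add: lookup_sum lookup_Tb)
qed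

lemma hcarrier_eq_span: "hcarrier X = hs.span (Tb ` X)"
proof
  show "hcarrier X \<subseteq> hs.span (Tb ` X)"
  proof
    fix h assume h: "h \<in> hcarrier X"
    show "h \<in> hs.span (Tb ` X)"
      by (subst sum_lookup_Tb, intro hs.span_sum hs.span_scale hs.span_base)
         (use h in \<open>auto simp: hcarrier_def\<close>)
  qed
  show "hs.span (Tb ` X) \<subseteq> hcarrier X"
    by (rule hs.span_minimal) (auto simp: subspace_hcarrier)
qed

lemma subspace_hsmult_image:
  assumes "hs.subspace V"
  shows "hs.subspace (hsmult c ` V)"
proof -
  have "hsmult c x + hsmult c y \<in> hsmult c ` V" if "x \<in> V" "y \<in> V" for x y
    using that assms by (metis hs.scale_right_distrib hs.subspace_add imageI)
  moreover have "hsmult d (hsmult c x) \<in> hsmult c ` V" if "x \<in> V" for d x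
    using that assms by (metis hs.scale_left_commute hs.subspace_scale imageI)
  ultimately show ?thesis
    using assms by (auto simp: hs.subspace_def intro: image_eqI[of _ _ 0])
qed

section \<open>Linear extension of maps given on the basis\<close>

definition lin_ext :: "('w \<Rightarrow> ('u \<Rightarrow>\<^sub>0 lpoly)) \<Rightarrow> ('w \<Rightarrow>\<^sub>0 lpoly) \<Rightarrow> ('u \<Rightarrow>\<^sub>0 lpoly)" where
  "lin_ext f h = (\<Sum>x\<in>Poly_Mapping.keys h. hsmult (Poly_Mapping.lookup h x) (f x))"

lemma lin_ext_superset:
  assumes "finite B" "Poly_Mapping.keys h \<subseteq> B"
  shows "lin_ext f h = (\<Sum>x\<in>B. hsmult (Poly_Mapping.lookup h x) (f x))"
  unfolding lin_ext_def
  by (rule sum.mono_neutral_left) (use assms in \<open>auto simp: in_keys_iff\<close>)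

lemma lin_ext_add: "lin_ext f (g + h) = lin_ext f g + lin_ext f h"
proof -
  let ?B = "Poly_Mapping.keys g \<union> Poly_Mapping.keys h"
  have "Poly_Mapping.keys (g + h) \<subseteq> ?B" by (rule keys_add)
  then show ?thesis
    by (simp add: lin_ext_superset[of ?B] lookup_add hs.scale_left_distrib sum.distrib)
qed

lemma lin_ext_hsmult: "lin_ext f (hsmult c h) = hsmult c (lin_ext f h)"
proof -
  have "Poly_Mapping.keys (hsmult c h) \<subseteq> Poly_Mapping.keys h" by (auto simp: in_keys_iff)
  then show ?thesis
    by (simp add: lin_ext_superset[of "Poly_Mapping.keys h"] hs.scale_sum_right)
qed

lemma lin_ext_zero [simp]: "lin_ext f 0 = 0"
  by (simp add: lin_ext_def)

lemma lin_ext_diff: "lin_ext f (g - h) = lin_ext f g - lin_ext f h"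
  using lin_ext_add[of f "g - h" h] by simp

lemma lin_ext_Tb [simp]: "lin_ext f (Tb x) = f x"
  by (simp add: lin_ext_superset[of "{x}"] lookup_Tb Tb_def)

lemma lin_ext_sum: "lin_ext f (\<Sum>i\<in>I. h i) = (\<Sum>i\<in>I. lin_ext f (h i))"
  by (induction I rule: infinite_finite_induct) (auto simp: lin_ext_add)

lemma lin_ext_in:
  assumes "hs.subspace V" "\<And>x. x \<in> Poly_Mapping.keys h \<Longrightarrow> f x \<in> V"
  shows "lin_ext f h \<in> V"
  unfolding lin_ext_def using assms by (auto intro!: hs.subspace_sum hs.subspace_scale)

section \<open>Divisibility by \<open>v - 1\<close> among Laurent polynomials\<close>

abbreviation pv :: lpoly where "pv \<equiv> lv - 1"

lemma lookup_pv_mult: "Poly_Mapping.lookup (pv * c) k = Poly_Mapping.lookup c (k - 1) - Poly_Mapping.lookup c k"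
proof -
  have "Poly_Mapping.lookup (lv * c) k = Sum_any (\<lambda>l. Poly_Mapping.lookup lv l *
      Sum_any (\<lambda>q. Poly_Mapping.lookup c q when k = l + q))"
    by (simp add: lookup_mult)
  also have "\<dots> = Sum_any (\<lambda>l. Sum_any (\<lambda>q. Poly_Mapping.lookup c q when k = l + q) when l = 1)"
    by (rule Sum_any.cong) (auto simp: lv_def lookup_single when_def)
  also have "\<dots> = Sum_any (\<lambda>q. Poly_Mapping.lookup c q when k = 1 + q)"
    by simp
  also have "\<dots> = Sum_any (\<lambda>q. Poly_Mapping.lookup c q when q = k - 1)"
    by (rule Sum_any.cong) (auto simp: when_def)
  finally have "Poly_Mapping.lookup (lv * c) k = Poly_Mapping.lookup c (k - 1)" by simp
  then show ?thesis by (simp add: left_diff_distrib lookup_minus)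
qed

lemma pv_nonzero: "pv \<noteq> 0"
  by (metis lv_def lookup_single_eq lookup_single_not_eq right_minus_eq single_one zero_neq_one)

lemma hsmult_pv_cancel: "hsmult pv g = hsmult pv h \<Longrightarrow> g = h"
  by (metis (no_types, lifting) lookup_hsmult mult_left_cancel poly_mapping_eqI pv_nonzero)

text \<open>A degree that does not see the units \<open>v^k\<close>; it is the termination measure
  for dividing a relation by \<open>v - 1\<close>.\<close>

definition width :: "lpoly \<Rightarrow> nat" where
  "width c = (if c = 0 then 0 else nat (Max (Poly_Mapping.keys c) - Min (Poly_Mapping.keys c) + 1))"

text \<open>At the exponents \<open>Max + 1\<close> and \<open>Min\<close> only one of the two
  copies of \<open>c\<close> in \<open>v * c - c\<close> contributes, so both coefficients survive
  and the spread grows.\<close>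

lemma width_pv_mult:
  assumes "c \<noteq> 0"
  shows "width c < width (pv * c)"
proof -
  have ne: "Poly_Mapping.keys c \<noteq> {}" using assms by simp
  let ?M = "Max (Poly_Mapping.keys c)" and ?m = "Min (Poly_Mapping.keys c)"
  have M: "?M \<in> Poly_Mapping.keys c" "?m \<in> Poly_Mapping.keys c" using ne by (auto intro: Max_in Min_in)
  have "?M + 1 \<notin> Poly_Mapping.keys c" using Max_ge[of "Poly_Mapping.keys c" "?M + 1"] by auto
  then have 1: "?M + 1 \<in> Poly_Mapping.keys (pv * c)"
    using M by (simp add: in_keys_iff lookup_pv_mult)
  have "?m - 1 \<notin> Poly_Mapping.keys c" using Min_le[of "Poly_Mapping.keys c" "?m - 1"] by auto
  then have 2: "?m \<in> Poly_Mapping.keys (pv * c)"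
    using M by (simp add: in_keys_iff lookup_pv_mult)
  have "?M + 1 \<le> Max (Poly_Mapping.keys (pv * c))" "Min (Poly_Mapping.keys (pv * c)) \<le> ?m"
    using 1 2 by auto
  moreover have "?m \<le> ?M" using M by auto
  ultimately have "?M - ?m + 1 < Max (Poly_Mapping.keys (pv * c)) - Min (Poly_Mapping.keys (pv * c)) + 1" "0 \<le> ?M - ?m + 1"
    by linarith+
  then show ?thesis using assms pv_nonzero unfolding width_def by simp
qed

section \<open>Commutators modulo \<open>v - 1\<close>\<close>

text \<open>The product is controlled only on \<open>H\<close>, the elements supported on
  \<open>G\<close>; hence the membership premises throughout.\<close>

locale bilinear_mult = group G for G (structure) +
  fixes m :: "('a \<Rightarrow>\<^sub>0 lpoly) \<Rightarrow> ('a \<Rightarrow>\<^sub>0 lpoly) \<Rightarrow> ('a \<Rightarrow>\<^sub>0 lpoly)"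
  assumes hm_closed: "\<lbrakk>x \<in> hcarrier (carrier G); y \<in> hcarrier (carrier G)\<rbrakk> \<Longrightarrow> m x y \<in> hcarrier (carrier G)"
    and m_add_left: "\<lbrakk>x \<in> hcarrier (carrier G); y \<in> hcarrier (carrier G); z \<in> hcarrier (carrier G)\<rbrakk>
          \<Longrightarrow> m (x + y) z = m x z + m y z"
    and m_add_right: "\<lbrakk>x \<in> hcarrier (carrier G); y \<in> hcarrier (carrier G); z \<in> hcarrier (carrier G)\<rbrakk>
          \<Longrightarrow> m x (y + z) = m x y + m x z"
    and hm_assoc: "\<lbrakk>x \<in> hcarrier (carrier G); y \<in> hcarrier (carrier G); z \<in> hcarrier (carrier G)\<rbrakk>
          \<Longrightarrow> m (m x y) z = m x (m y z)"
    and m_scale_left: "\<lbrakk>x \<in> hcarrier (carrier G); y \<in> hcarrier (carrier G)\<rbrakk>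
          \<Longrightarrow> m (hsmult c x) y = hsmult c (m x y)"
    and m_scale_right: "\<lbrakk>x \<in> hcarrier (carrier G); y \<in> hcarrier (carrier G)\<rbrakk>
          \<Longrightarrow> m x (hsmult c y) = hsmult c (m x y)"
begin

abbreviation H where "H \<equiv> hcarrier (carrier G)"

lemma H_closed [simp]:
  "x \<in> H \<Longrightarrow> y \<in> H \<Longrightarrow> x + y \<in> H" "x \<in> H \<Longrightarrow> y \<in> H \<Longrightarrow> x - y \<in> H"
  "x \<in> H \<Longrightarrow> hsmult c x \<in> H" "0 \<in> H" "x \<in> H \<Longrightarrow> y \<in> H \<Longrightarrow> m x y \<in> H"
  using subspace_hcarrier[of "carrier G"]
  by (auto intro: hs.subspace_add hs.subspace_diff hs.subspace_scale hs.subspace_0 hm_closed)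

lemma m_diff_left: "\<lbrakk>x \<in> H; y \<in> H; z \<in> H\<rbrakk> \<Longrightarrow> m (x - y) z = m x z - m y z"
  using m_add_left[of "x - y" y z] by simp

lemma m_diff_right: "\<lbrakk>x \<in> H; y \<in> H; z \<in> H\<rbrakk> \<Longrightarrow> m x (y - z) = m x y - m x z"
  using m_add_right[of x "y - z" z] by simp

lemma m_zero: "x \<in> H \<Longrightarrow> m 0 x = 0" "x \<in> H \<Longrightarrow> m x 0 = 0"
  using m_diff_left[of 0 0 x] m_diff_right[of x 0 0] by auto

lemmas m_bilinear = m_add_left m_add_right m_diff_left m_diff_right m_scale_left m_scale_right m_zero

definition cmt where "cmt x y = m x y - m y x"

abbreviation CS where "CS \<equiv> comm_span (carrier G) m"

lemma comm_span_eq_span: "CS = hs.span {cmt x y | x y. x \<in> H \<and> y \<in> H}" (is "_ = hs.span ?C")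
proof
  show "CS \<subseteq> hs.span ?C"
  proof
    fix z assume "z \<in> CS"
    then show "z \<in> hs.span ?C"
    proof induction
      case (step u x y c)
      then show ?case
        by (intro hs.span_add hs.span_scale step.IH, intro hs.span_base) (auto simp: cmt_def)
    qed (rule hs.span_zero)
  qed
  show "hs.span ?C \<subseteq> CS"
  proof
    fix z assume "z \<in> hs.span ?C"
    then show "z \<in> CS"
    proof (induction rule: hs.span_induct_alt)
      case (step c x y)
      then show ?case using comm_span.step[of y "carrier G" m _ _ c] by (auto simp: cmt_def add.commute)
    qed (rule comm_span.zero)
  qed
qed

lemma subspace_CS: "hs.subspace CS"
  unfolding comm_span_eq_span by simp

lemma cmt_in_CS: "x \<in> H \<Longrightarrow> y \<in> H \<Longrightarrow> cmt x y \<in> CS"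
  unfolding comm_span_eq_span by (rule hs.span_base) auto

lemma cmt_bilinear:
  "\<lbrakk>x \<in> H; y \<in> H; z \<in> H\<rbrakk> \<Longrightarrow> cmt (x + y) z = cmt x z + cmt y z"
  "\<lbrakk>x \<in> H; y \<in> H; z \<in> H\<rbrakk> \<Longrightarrow> cmt z (x + y) = cmt z x + cmt z y"
  "\<lbrakk>x \<in> H; z \<in> H\<rbrakk> \<Longrightarrow> cmt (hsmult c x) z = hsmult c (cmt x z)"
  "\<lbrakk>x \<in> H; z \<in> H\<rbrakk> \<Longrightarrow> cmt z (hsmult c x) = hsmult c (cmt z x)"
  "z \<in> H \<Longrightarrow> cmt 0 z = 0" "z \<in> H \<Longrightarrow> cmt z 0 = 0"
  by (auto simp: cmt_def m_bilinear hs.scale_right_diff_distrib)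

text \<open>Bilinearity, applied to one argument at a time, reduces all commutators to those of
  basis elements.\<close>

lemma comm_span_subsetI:
  assumes Q: "hs.subspace Q"
    and gen: "\<And>g h. \<lbrakk>g \<in> carrier G; h \<in> carrier G\<rbrakk> \<Longrightarrow> cmt (Tb g) (Tb h) \<in> Q"
  shows "CS \<subseteq> Q"
proof -
  have 1: "cmt (Tb g) y \<in> Q" if g: "g \<in> carrier G" and y: "y \<in> H" for g y
  proof -
    have "hs.span (Tb ` carrier G) \<subseteq> {y \<in> H. cmt (Tb g) y \<in> Q}"
      using Q g gen by (intro hs.span_minimal) (auto simp: hs.subspace_def cmt_bilinear)
    then show ?thesis using y by (auto simp: hcarrier_eq_span)
  qed
  have 2: "cmt x y \<in> Q" if x: "x \<in> H" and y: "y \<in> H" for x y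
  proof -
    have "hs.span (Tb ` carrier G) \<subseteq> {x \<in> H. cmt x y \<in> Q}"
      using Q y 1 by (intro hs.span_minimal) (auto simp: hs.subspace_def cmt_bilinear)
    then show ?thesis using x by (auto simp: hcarrier_eq_span)
  qed
  show ?thesis unfolding comm_span_eq_span
    by (rule hs.span_minimal) (use 2 Q in auto)
qed

text \<open>The modulus is \<open>(v - 1)[H,H]\<close> and not \<open>(v - 1)H\<close>: that the
  latter meets \<open>[H,H]\<close> in nothing more is the torsion-freeness to be proved.\<close>

definition congJ (infix "\<approx>" 50) where "a \<approx> b \<longleftrightarrow> a - b \<in> hsmult pv ` CS"

lemma subspace_J: "hs.subspace (hsmult pv ` CS)"
  by (rule subspace_hsmult_image[OF subspace_CS])

lemma congJ_refl [simp]: "a \<approx> a"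
  using hs.subspace_0[OF subspace_J] by (simp add: congJ_def)

lemma congJ_sym: "a \<approx> b \<Longrightarrow> b \<approx> a"
  using hs.subspace_neg[OF subspace_J, of "a - b"] by (simp add: congJ_def)

lemma congJ_trans [trans]: "a \<approx> b \<Longrightarrow> b \<approx> c \<Longrightarrow> a \<approx> c"
  using hs.subspace_add[OF subspace_J, of "a - b" "b - c"] by (simp add: congJ_def)

lemma congJ_add: "a \<approx> b \<Longrightarrow> c \<approx> d \<Longrightarrow> a + c \<approx> b + d"
  using hs.subspace_add[OF subspace_J, of "a - b" "c - d"] by (simp add: congJ_def algebra_simps)

lemma congJ_diff: "a \<approx> b \<Longrightarrow> c \<approx> d \<Longrightarrow> a - c \<approx> b - d"
  using hs.subspace_diff[OF subspace_J, of "a - b" "c - d"] by (simp add: congJ_def algebra_simps)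

lemma congJ_scale: "a \<approx> b \<Longrightarrow> hsmult c a \<approx> hsmult c b"
  using hs.subspace_scale[OF subspace_J, of "a - b" c]
  by (simp add: congJ_def hs.scale_right_diff_distrib)

text \<open>Changing an entry by an element of \<open>(v - 1)H\<close> changes the commutator by
  \<open>v - 1\<close> times a commutator, so its class depends only on the entries at
  \<open>v = 1\<close>.\<close>

lemma cmt_congJ:
  assumes "x \<in> H" "y \<in> H" "d \<in> H"
  shows "cmt (x + hsmult pv d) y \<approx> cmt x y" "cmt y (x + hsmult pv d) \<approx> cmt y x"
  using assms by (auto simp: congJ_def cmt_bilinear intro!: imageI cmt_in_CS)

end

text \<open>The two properties of the Hecke algebra on which the argument rests: at
  \<open>v = 1\<close> the product is that of the group, and for some \<open>n > 0\<close> the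
  commuting pair \<open>g^n\<close>, \<open>g^{-n} x\<close> lifts to elements of \<open>H\<close>
  that commute exactly.\<close>

locale deformed_group_algebra = bilinear_mult +
  assumes T_mult: "\<lbrakk>x \<in> carrier G; y \<in> carrier G\<rbrakk>
      \<Longrightarrow> \<exists>d\<in>H. m (Tb x) (Tb y) = Tb (x \<otimes> y) + hsmult pv d"
    and commuting_lift: "\<lbrakk>x \<in> carrier G; g \<in> carrier G; g \<otimes> x = x \<otimes> g\<rbrakk> \<Longrightarrow>
      \<exists>n>0. \<exists>b\<in>H. \<exists>d\<in>H. b = Tb (inv (g [^] (n::nat)) \<otimes> x) + hsmult pv d \<and>
         m (Tb (g [^] n)) b = m b (Tb (g [^] n))"
begin

section \<open>The commutator cocycle\<close>

definition F where "F g x = cmt (Tb g) (Tb (inv g \<otimes> x))"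

text \<open>Telescoping: \<open>abc - cab = (abc - bca) + (bca - cab)\<close>.\<close>

lemma cmt_mult:
  assumes "a \<in> H" "b \<in> H" "c \<in> H"
  shows "cmt (m a b) c = cmt a (m b c) + cmt b (m c a)"
  using assms by (simp add: cmt_def hm_assoc)

lemma F_in_CS: "g \<in> carrier G \<Longrightarrow> x \<in> carrier G \<Longrightarrow> F g x \<in> CS"
  unfolding F_def by (rule cmt_in_CS) auto

text \<open>This is \<open>cmt_mult\<close> for \<open>T_g\<close>, \<open>T_h\<close>,
  \<open>T_k\<close> with \<open>ghk = x\<close>: the three products that occur are basis elements
  up to \<open>(v - 1)H\<close>, and \<open>cmt_congJ\<close> discards the error.\<close>

lemma F_mult:
  assumes g: "g \<in> carrier G" "h \<in> carrier G" and x: "x \<in> carrier G"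
  shows "F (g \<otimes> h) x \<approx> F g x + F h (inv g \<otimes> x \<otimes> g)"
proof -
  let ?k = "inv (g \<otimes> h) \<otimes> x"
  have k: "?k \<in> carrier G" using assms by simp
  obtain d1 where d1: "d1 \<in> H" "m (Tb g) (Tb h) = Tb (g \<otimes> h) + hsmult pv d1" using T_mult g by blast
  obtain d2 where d2: "d2 \<in> H" "m (Tb h) (Tb ?k) = Tb (h \<otimes> ?k) + hsmult pv d2" using T_mult g k by blast
  obtain d3 where d3: "d3 \<in> H" "m (Tb ?k) (Tb g) = Tb (?k \<otimes> g) + hsmult pv d3" using T_mult g k by blast
  have hk: "h \<otimes> ?k = inv g \<otimes> x" 
    using assms by (simp add: inv_mult_group m_assoc[symmetric])
  have kg: "?k \<otimes> g = inv h \<otimes> (inv g \<otimes> x \<otimes> g)"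
    using assms by (simp add: inv_mult_group m_assoc)
  have "F (g \<otimes> h) x \<approx> cmt (m (Tb g) (Tb h)) (Tb ?k)"
    unfolding F_def d1 by (rule congJ_sym, rule cmt_congJ) (use assms d1 k in auto)
  also have "cmt (m (Tb g) (Tb h)) (Tb ?k) = cmt (Tb g) (m (Tb h) (Tb ?k)) + cmt (Tb h) (m (Tb ?k) (Tb g))"
    using assms k by (intro cmt_mult) auto
  also have "\<dots> \<approx> F g x + F h (inv g \<otimes> x \<otimes> g)"
    unfolding F_def d2 d3 hk kg
    by (intro congJ_add cmt_congJ) (use assms d2 d3 in auto)
  finally show ?thesis .
qed


text \<open>The cocycle rule for the product of \<open>1\<close> with itself gives
  \<open>F = F + F\<close>.\<close>

lemma F_one:
  assumes x: "x \<in> carrier G"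
  shows "F \<one> x \<approx> 0"
proof (rule congJ_sym)
  show "0 \<approx> F \<one> x"
    using congJ_diff[OF F_mult[of \<one> \<one> x] congJ_refl[of "F \<one> x"]] x by simp
qed

text \<open>Conjugation by powers of \<open>g\<close> fixes \<open>x\<close>, so the cocycle rule
  becomes additivity.\<close>

lemma F_pow:
  assumes "x \<in> carrier G" "g \<in> carrier G" "g \<otimes> x = x \<otimes> g"
  shows "F (g [^] (n::nat)) x \<approx> hsmult (of_nat n) (F g x)"
proof (induction n)
  case (Suc n)
  have com: "g [^] n \<otimes> x = x \<otimes> g [^] n"
    using assms by (induction n) (simp_all add: m_assoc, metis m_assoc nat_pow_closed)
  then have "inv (g [^] n) \<otimes> x \<otimes> g [^] n = x"
    using assms by (simp add: m_assoc) (metis inv_solve_left m_closed nat_pow_closed)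
  then have "F (g [^] Suc n) x \<approx> F (g [^] n) x + F g x"
    using F_mult[of "g [^] n" g x] assms by simp
  also have "\<dots> \<approx> hsmult (of_nat n) (F g x) + F g x"
    by (intro congJ_add Suc.IH congJ_refl)
  finally show ?case by (simp add: hs.scale_left_distrib add.commute)
qed (use assms F_one in simp)

lemma F_commuting:
  assumes x: "x \<in> carrier G" and g: "g \<in> carrier G" "g \<otimes> x = x \<otimes> g"
  shows "F g x \<approx> 0"
proof -
  obtain n b d where n: "n > (0::nat)" and b: "b \<in> H" "d \<in> H"
    "b = Tb (inv (g [^] n) \<otimes> x) + hsmult pv d" "m (Tb (g [^] n)) b = m b (Tb (g [^] n))"
    using commuting_lift[OF assms] by blast
  \<comment> \<open>The lift \<open>b\<close> may replace the basis element in the second entry, and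
    its commutator with the first entry is exactly zero.\<close>
  have "cmt (Tb (g [^] n)) b \<approx> F (g [^] n) x"
    unfolding F_def b(3) by (rule cmt_congJ) (use x g b in auto)
  then have "F (g [^] n) x \<approx> 0"
    using b(4) by (intro congJ_sym[of 0]) (simp add: cmt_def)
  then have "hsmult (of_nat n) (F g x) \<approx> 0"
    using F_pow[OF assms] congJ_sym congJ_trans by blast
  \<comment> \<open>Division by \<open>n\<close> is possible because the coefficients contain the
    complex numbers.\<close>
  then have "hsmult (Poly_Mapping.single 0 (1 / of_nat n)) (hsmult (of_nat n) (F g x)) \<approx> 
      hsmult (Poly_Mapping.single 0 (1 / of_nat n)) 0"
    by (rule congJ_scale)
  moreover have "Poly_Mapping.single 0 (1 / of_nat n) * of_nat n = (1::lpoly)"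
    using n by (simp add: mult_single flip: single_of_nat)
  ultimately show ?thesis by simp
qed

section \<open>Class representatives and a potential for the cocycle\<close>

definition cls where "cls x = {inv g \<otimes> x \<otimes> g | g. g \<in> carrier G}"

text \<open>The choice depends on the set \<open>cls x\<close> alone, so it is constant on conjugacy
  classes.\<close>

definition rep where "rep x = (SOME r. r \<in> cls x)"

lemma cls_conj:
  assumes "x \<in> carrier G" "g \<in> carrier G"
  shows "cls (inv g \<otimes> x \<otimes> g) = cls x"
proof -
  have sub: "cls (inv g \<otimes> x \<otimes> g) \<subseteq> cls x" if "x \<in> carrier G" "g \<in> carrier G" for x g
  proof
    fix y assume "y \<in> cls (inv g \<otimes> x \<otimes> g)"
    then obtain h where "h \<in> carrier G" "y = inv h \<otimes> (inv g \<otimes> x \<otimes> g) \<otimes> h"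
      by (auto simp: cls_def)
    then have "y = inv (g \<otimes> h) \<otimes> x \<otimes> (g \<otimes> h)" "g \<otimes> h \<in> carrier G"
      using that by (auto simp: inv_mult_group m_assoc)
    then show "y \<in> cls x" unfolding cls_def by blast
  qed
  have "x = inv (inv g) \<otimes> (inv g \<otimes> x \<otimes> g) \<otimes> inv g"
    using assms by (simp add: m_assoc) (simp add: m_assoc[symmetric])
  then show ?thesis using sub[of x g] sub[of "inv g \<otimes> x \<otimes> g" "inv g"] assms by auto
qed

lemma rep_in_cls:
  assumes "x \<in> carrier G"
  shows "rep x \<in> cls x"
proof -
  have "x \<in> cls x" using assms by (auto simp: cls_def intro!: exI[of _ \<one>])
  then show ?thesis unfolding rep_def by (rule someI)
qed

lemma rep_carrier: "x \<in> carrier G \<Longrightarrow> rep x \<in> carrier G"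
  using rep_in_cls[of x] by (auto simp: cls_def)

lemma rep_conj: "x \<in> carrier G \<Longrightarrow> g \<in> carrier G \<Longrightarrow> rep (inv g \<otimes> x \<otimes> g) = rep x"
  unfolding rep_def by (simp only: cls_conj)

lemma ex_conj_rep:
  assumes "x \<in> carrier G"
  shows "\<exists>g\<in>carrier G. x = inv g \<otimes> rep x \<otimes> g"
proof -
  obtain g where g: "g \<in> carrier G" "rep x = inv g \<otimes> x \<otimes> g"
    using rep_in_cls[OF assms] by (auto simp: cls_def)
  then have "x = inv (inv g) \<otimes> rep x \<otimes> inv g"
    using assms by (simp add: m_assoc) (simp add: m_assoc[symmetric])
  then show ?thesis using g by blast
qed

text \<open>A cocycle on a groupoid that vanishes on the stabilizers is a coboundary:
  \<open>p x\<close> is, up to sign, the cocycle along a chosen path from the class representative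
  to \<open>x\<close>, and two such paths differ by a loop.\<close>

lemma ex_potential:
  obtains p where "\<And>x. x \<in> carrier G \<Longrightarrow> p x \<in> CS"
    "\<And>g h. \<lbrakk>g \<in> carrier G; h \<in> carrier G\<rbrakk> \<Longrightarrow> cmt (Tb g) (Tb h) \<approx> p (g \<otimes> h) - p (h \<otimes> g)"
proof -
  obtain a where a: "\<And>x. x \<in> carrier G \<Longrightarrow> a x \<in> carrier G \<and> x = inv (a x) \<otimes> rep x \<otimes> a x"
    using ex_conj_rep by metis
  define p where "p x = - F (a x) (rep x)" for x
  have "F g x \<approx> p x - p (inv g \<otimes> x \<otimes> g)" if g: "g \<in> carrier G" and x: "x \<in> carrier G" for g x
  proof -
    define y where "y = inv g \<otimes> x \<otimes> g"
    have y: "y \<in> carrier G" using g x by (simp add: y_def)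
    define r where "r = rep x"
    have r: "rep y = r" "r \<in> carrier G" using rep_conj[OF x g] rep_carrier[OF x] by (auto simp: y_def r_def)
    define A B where "A = a x" and "B = a y"
    have A: "A \<in> carrier G" "x = inv A \<otimes> r \<otimes> A" using a[OF x] by (auto simp: A_def r_def)
    have B: "B \<in> carrier G" "y = inv B \<otimes> r \<otimes> B" using a[OF y] r by (auto simp: B_def)
    \<comment> \<open>The loop at \<open>r\<close>: along \<open>A\<close> to \<open>x\<close>,
      along \<open>g\<close> to \<open>y\<close>, and back along the inverse of
      \<open>B\<close>.\<close>
    define z where "z = A \<otimes> g \<otimes> inv B"
    have z: "z \<in> carrier G" using A B g by (simp add: z_def)
    have Ax: "A \<otimes> x = r \<otimes> A" using A r by (simp add: m_assoc) (simp add: m_assoc[symmetric])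
    have gy: "g \<otimes> y = x \<otimes> g" using g x unfolding y_def by (simp add: m_assoc) (simp add: m_assoc[symmetric])
    have By: "B \<otimes> y = r \<otimes> B" using B r by (simp add: m_assoc) (simp add: m_assoc[symmetric])
    have Br: "inv B \<otimes> r = y \<otimes> inv B"
      using By B r y by (metis inv_closed inv_solve_left inv_solve_right m_assoc m_closed)
    have "z \<otimes> r = A \<otimes> (g \<otimes> y) \<otimes> inv B"
      using A(1) B(1) g r y by (simp add: z_def m_assoc Br)
    also have "\<dots> = r \<otimes> z"
      using A(1) B(1) g r x by (simp add: z_def gy m_assoc) (simp add: Ax m_assoc[symmetric])
    finally have zr: "z \<otimes> r = r \<otimes> z" .
    then have zrz: "inv z \<otimes> r \<otimes> z = r"
      using z r by (simp add: m_assoc) (metis inv_solve_left m_closed)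
    have zB: "z \<otimes> B = A \<otimes> g"
      using A(1) B(1) g by (simp add: z_def m_assoc)
    \<comment> \<open>The element \<open>Ag = zB\<close> is expanded in both ways; in the second
      expansion the loop \<open>z\<close> contributes nothing.\<close>
    have 1: "F (A \<otimes> g) r \<approx> F A r + F g x"
      using F_mult[of A g r] A g r by simp
    have 2: "F (A \<otimes> g) r \<approx> 0 + F B r"
      using congJ_trans[OF F_mult[of z B r] congJ_add[OF F_commuting[of r z] congJ_refl]] z r B zr zrz zB
      by simp
    have "F A r + F g x \<approx> F B r"
      using congJ_trans[OF congJ_sym[OF 1] 2] by simp
    then have "F A r + F g x - F A r \<approx> F B r - F A r"
      by (intro congJ_diff congJ_refl)
    then show ?thesis unfolding p_def y_def[symmetric] using r by (simp add: A_def B_def r_def)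
  qed
  note * = this
  show thesis
  proof (rule that[of p])
    show "p x \<in> CS" if "x \<in> carrier G" for x
      unfolding p_def using that a rep_carrier
      by (intro hs.subspace_neg[OF subspace_CS] F_in_CS) auto
    show "cmt (Tb g) (Tb h) \<approx> p (g \<otimes> h) - p (h \<otimes> g)" if "g \<in> carrier G" "h \<in> carrier G" for g h
      using *[of g "g \<otimes> h"] that by (simp add: F_def m_assoc[symmetric])
  qed
qed

section \<open>Torsion-freeness of the cocenter, and descent\<close>

lemma subspace_lin_ext_preimage:
  assumes "hs.subspace V"
  shows "hs.subspace {z. lin_ext f z \<in> V}"
  using assms by (auto simp: hs.subspace_def lin_ext_add lin_ext_hsmult)

lemma comm_span_torsion_free:
  assumes z: "z \<in> H" "hsmult pv z \<in> CS"
  shows "z \<in> CS"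
proof -
  obtain p where p: "\<And>x. x \<in> carrier G \<Longrightarrow> p x \<in> CS"
    "\<And>g h. \<lbrakk>g \<in> carrier G; h \<in> carrier G\<rbrakk> \<Longrightarrow> cmt (Tb g) (Tb h) \<approx> p (g \<otimes> h) - p (h \<otimes> g)"
    by (rule ex_potential) (rule that)
  \<comment> \<open>The extension of \<open>p\<close> sends all of \<open>H\<close> into
    \<open>[H,H]\<close>, hence \<open>(v - 1)H\<close> into \<open>(v - 1)[H,H]\<close>. Both the
    error terms below and the final division rest on this.\<close>
  have pz: "lin_ext p h \<in> CS" if "h \<in> H" for h
    using that p(1) by (intro lin_ext_in[OF subspace_CS]) (auto simp: hcarrier_def)
  let ?Q = "{y. y - lin_ext p y \<in> hsmult pv ` CS}"
  have "CS \<subseteq> ?Q"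
  proof (rule comm_span_subsetI)
    have *: "x + y - (lin_ext p x + lin_ext p y) = (x - lin_ext p x) + (y - lin_ext p y)" for x y
      by simp
    show "hs.subspace ?Q"
      using subspace_J unfolding hs.subspace_def
      by (auto simp: lin_ext_add lin_ext_hsmult * simp flip: hs.scale_right_diff_distrib)
  next
    fix g h assume gh: "g \<in> carrier G" "h \<in> carrier G"
    obtain d where d: "d \<in> H" "m (Tb g) (Tb h) = Tb (g \<otimes> h) + hsmult pv d" using T_mult gh by blast
    obtain e where e: "e \<in> H" "m (Tb h) (Tb g) = Tb (h \<otimes> g) + hsmult pv e" using T_mult gh by blast
    have "cmt (Tb g) (Tb h) = Tb (g \<otimes> h) - Tb (h \<otimes> g) + hsmult pv (d - e)"
      by (simp add: cmt_def d e hs.scale_right_diff_distrib)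
    then have "lin_ext p (cmt (Tb g) (Tb h)) - (p (g \<otimes> h) - p (h \<otimes> g)) = hsmult pv (lin_ext p (d - e))"
      by (simp add: lin_ext_add lin_ext_diff lin_ext_hsmult)
    then have "lin_ext p (cmt (Tb g) (Tb h)) \<approx> p (g \<otimes> h) - p (h \<otimes> g)"
      using pz[of "d - e"] d e by (simp add: congJ_def)
    then have "cmt (Tb g) (Tb h) \<approx> lin_ext p (cmt (Tb g) (Tb h))"
      using p(2)[OF gh] congJ_sym congJ_trans by blast
    then show "cmt (Tb g) (Tb h) \<in> ?Q" by (simp add: congJ_def)
  qed
  then have "hsmult pv z - lin_ext p (hsmult pv z) \<in> hsmult pv ` CS"
    using z by blast
  moreover have "lin_ext p (hsmult pv z) \<in> hsmult pv ` CS"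
    using pz[OF z(1)] unfolding lin_ext_hsmult by (rule imageI)
  ultimately have "hsmult pv z - lin_ext p (hsmult pv z) + lin_ext p (hsmult pv z) \<in> hsmult pv ` CS"
    by (rule hs.subspace_add[OF subspace_J])
  then have "hsmult pv z \<in> hsmult pv ` CS"
    by simp
  then obtain y where "hsmult pv z = hsmult pv y" "y \<in> CS"
    by (rule imageE)
  then show ?thesis using hsmult_pv_cancel[of z y] by simp
qed

text \<open>Collecting coefficients by conjugacy class is the universal trace of the group algebra;
  it kills commutators at \<open>v = 1\<close> because \<open>gh\<close> and \<open>hg\<close> are
  conjugate.\<close>

lemma lin_ext_rep_comm_span:
  assumes "z \<in> CS"
  shows "lin_ext (\<lambda>x. Tb (rep x)) z \<in> hsmult pv ` UNIV"
proof -
  let ?L = "lin_ext (\<lambda>x. Tb (rep x))" and ?V = "hsmult pv ` (UNIV :: ('a \<Rightarrow>\<^sub>0 lpoly) set)"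
  have "CS \<subseteq> {z. ?L z \<in> ?V}"
  proof (rule comm_span_subsetI[OF subspace_lin_ext_preimage[OF subspace_hsmult_image]])
    fix g h assume gh: "g \<in> carrier G" "h \<in> carrier G"
    obtain d where d: "d \<in> H" "m (Tb g) (Tb h) = Tb (g \<otimes> h) + hsmult pv d" using T_mult gh by blast
    obtain e where e: "e \<in> H" "m (Tb h) (Tb g) = Tb (h \<otimes> g) + hsmult pv e" using T_mult gh by blast
    have "h \<otimes> g = inv g \<otimes> (g \<otimes> h) \<otimes> g" using gh by (simp add: m_assoc[symmetric])
    then have "rep (h \<otimes> g) = rep (g \<otimes> h)" using rep_conj[of "g \<otimes> h" g] gh by simp
    then have "?L (cmt (Tb g) (Tb h)) = hsmult pv (?L (d - e))"
      by (simp add: cmt_def d e lin_ext_add lin_ext_diff lin_ext_hsmult hs.scale_right_diff_distrib)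
    then show "cmt (Tb g) (Tb h) \<in> {z. ?L z \<in> ?V}" by simp
  qed (rule hs.subspace_UNIV)
  then show ?thesis using assms by blast
qed

text \<open>Descent on the total width: the trace at \<open>v = 1\<close> shows that
  \<open>v - 1\<close> divides every coefficient, and torsion-freeness makes the quotients
  \<open>d\<close> the coefficients of another relation.\<close>

theorem linear_independent_mod_comm_span:
  fixes w :: "nat \<Rightarrow> 'a" and c :: "nat \<Rightarrow> lpoly"
  assumes w: "\<And>i. i < r \<Longrightarrow> w i \<in> carrier G"
    and nconj: "\<And>i j g. \<lbrakk>i < r; j < r; i \<noteq> j; g \<in> carrier G\<rbrakk> \<Longrightarrow> g \<otimes> w i \<noteq> w j \<otimes> g"
    and "(\<Sum>i<r. hsmult (c i) (Tb (w i))) \<in> CS" and "i < r"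
  shows "c i = 0"
  using assms(3,4)
proof (induction "\<Sum>i<r. width (c i)" arbitrary: c i rule: less_induct)
  case less
  \<comment> \<open>Distinct representatives keep the coefficients apart, so each can be read off
    from the trace.\<close>
  have inj: "rep (w i) \<noteq> rep (w j)" if ij: "i < r" "j < r" "i \<noteq> j" for i j
  proof
    assume eq: "rep (w i) = rep (w j)"
    obtain a where a: "a \<in> carrier G" "w i = inv a \<otimes> rep (w i) \<otimes> a" using ex_conj_rep[OF w[OF ij(1)]] by blast
    obtain b where b: "b \<in> carrier G" "w j = inv b \<otimes> rep (w i) \<otimes> b" using ex_conj_rep[OF w[OF ij(2)]] eq by metis
    let ?r = "rep (w i)"
    have r: "?r \<in> carrier G" using w ij by (simp add: rep_carrier)
    have "(inv b \<otimes> a) \<otimes> w i = inv b \<otimes> ?r \<otimes> a"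
      by (subst a(2)) (use a(1) b(1) r in \<open>simp add: m_assoc, simp add: m_assoc[symmetric]\<close>)
    also have "\<dots> = w j \<otimes> (inv b \<otimes> a)"
      by (subst b(2)) (use a(1) b(1) r in \<open>simp add: m_assoc, simp add: m_assoc[symmetric]\<close>)
    finally show False using nconj[OF ij, of "inv b \<otimes> a"] a b by simp
  qed
  have "lin_ext (\<lambda>x. Tb (rep x)) (\<Sum>i<r. hsmult (c i) (Tb (w i))) \<in> hsmult pv ` UNIV"
    by (rule lin_ext_rep_comm_span) (rule less.prems)
  then obtain y where y: "(\<Sum>i<r. hsmult (c i) (Tb (rep (w i)))) = hsmult pv y"
    by (auto simp: lin_ext_sum lin_ext_hsmult)
  have c_eq: "c j = pv * Poly_Mapping.lookup y (rep (w j))" if j: "j < r" for j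
  proof -
    have "Poly_Mapping.lookup (\<Sum>i<r. hsmult (c i) (Tb (rep (w i)))) (rep (w j))
      = (\<Sum>i<r. if i = j then c i else 0)"
      unfolding lookup_sum by (rule sum.cong) (use inj j in \<open>auto simp: lookup_Tb\<close>)
    also have "\<dots> = c j" using j by simp
    finally show ?thesis by (simp add: y)
  qed
  define d where "d j = Poly_Mapping.lookup y (rep (w j))" for j
  have cd: "c j = pv * d j" if "j < r" for j using c_eq[OF that] by (simp add: d_def)
  show ?case
  proof (rule ccontr)
    assume ne: "c i \<noteq> 0"
    have "hsmult pv (\<Sum>i<r. hsmult (d i) (Tb (w i))) = (\<Sum>i<r. hsmult (c i) (Tb (w i)))"
      unfolding hs.scale_sum_right by (rule sum.cong) (use cd in auto)
    then have "hsmult pv (\<Sum>i<r. hsmult (d i) (Tb (w i))) \<in> CS"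
      using less.prems(1) by (simp only:)
    moreover have "(\<Sum>i<r. hsmult (d i) (Tb (w i))) \<in> H"
      using w by (intro hs.subspace_sum[OF subspace_hcarrier]) auto
    ultimately have "(\<Sum>i<r. hsmult (d i) (Tb (w i))) \<in> CS"
      by (rule comm_span_torsion_free[rotated])
    \<comment> \<open>Vanishing coefficients keep their width; the strict drop comes from the index
      \<open>i\<close> with \<open>c i\<close> nonzero.\<close>
    moreover have "(\<Sum>i<r. width (d i)) < (\<Sum>i<r. width (c i))"
    proof (rule sum_strict_mono_ex1)
      show "\<forall>j\<in>{..<r}. width (d j) \<le> width (c j)"
      proof
        fix j assume "j \<in> {..<r}"
        then show "width (d j) \<le> width (c j)"
          using cd[of j] width_pv_mult[of "d j"] by (cases "d j = 0") (auto simp: width_def)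
      qed
      show "\<exists>j\<in>{..<r}. width (d j) < width (c j)"
        using cd[OF less.prems(2)] ne less.prems(2) width_pv_mult[of "d i"] by (intro bexI[of _ i]) auto
    qed simp
    ultimately have "d i = 0" using less.hyps[OF _ _ less.prems(2), of d] by simp
    then show False using cd ne less.prems(2) by simp
  qed
qed

end

lemma lv_lvinv [simp]: "lv * lvinv = 1"
  by (simp add: lv_def lvinv_def mult_single)

text \<open>The deviation of the quadratic relation from \<open>s^2 = 1\<close> is divisible by
  \<open>v - 1\<close>.\<close>

lemma lv_minus_lvinv: "lv - lvinv = pv * (lvinv * (lv + 1))"
proof -
  have "pv * (lvinv * (lv + 1)) = lv * lvinv * lv - lvinv"
    by (simp add: algebra_simps)
  then show ?thesis by simp
qed

section \<open>Hecke algebras as deformations of group algebras\<close>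

text \<open>Left descents and length-zero elements take the place of reduced expressions, and
  \<open>straight\<close> is the input for commuting pairs.\<close>

locale hecke_length = bilinear_mult +
  fixes len :: "'a \<Rightarrow> nat" and S :: "'a set"
  assumes len_one: "len \<one> = 0"
    and S_carrier: "s \<in> S \<Longrightarrow> s \<in> carrier G"
    and S_square: "s \<in> S \<Longrightarrow> s \<otimes> s = \<one>"
    and len_S: "s \<in> S \<Longrightarrow> len s = 1"
    and len_S_mult: "\<lbrakk>s \<in> S; x \<in> carrier G\<rbrakk> \<Longrightarrow>
      len (s \<otimes> x) = Suc (len x) \<or> len x = Suc (len (s \<otimes> x))"
    and descent: "\<lbrakk>x \<in> carrier G; len x > 0\<rbrakk> \<Longrightarrow> \<exists>s\<in>S. len x = Suc (len (s \<otimes> x))"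
    and len_zero_mult: "\<lbrakk>x \<in> carrier G; y \<in> carrier G; len x = 0\<rbrakk> \<Longrightarrow> len (x \<otimes> y) = len y"
    and T_add: "\<lbrakk>x \<in> carrier G; y \<in> carrier G; len (x \<otimes> y) = len x + len y\<rbrakk> \<Longrightarrow>
      m (Tb x) (Tb y) = Tb (x \<otimes> y)"
    and quadratic: "s \<in> S \<Longrightarrow> m (Tb s - hsmult lv (Tb \<one>)) (Tb s + hsmult lvinv (Tb \<one>)) = 0"
    and straight: "\<lbrakk>x \<in> carrier G; g \<in> carrier G; g \<otimes> x = x \<otimes> g\<rbrakk> \<Longrightarrow>
      \<exists>n>0. \<exists>j. len (g [^] (n::nat) \<otimes> ((g [^] n) [^] (j::nat) \<otimes> x)) = len (g [^] n) + len ((g [^] n) [^] j \<otimes> x)"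
begin

section \<open>Products and inverses of basis elements modulo \<open>v - 1\<close>\<close>

lemma m_Tb_one: 
  assumes "y \<in> H"
  shows "m (Tb \<one>) y = y" "m y (Tb \<one>) = y"
proof -
  have "hs.span (Tb ` carrier G) \<subseteq> {y \<in> H. m (Tb \<one>) y = y \<and> m y (Tb \<one>) = y}"
    by (rule hs.span_minimal) (auto simp: hs.subspace_def m_bilinear T_add len_one)
  then show "m (Tb \<one>) y = y" "m y (Tb \<one>) = y" using assms by (auto simp: hcarrier_eq_span)
qed

lemma T_S_square:
  assumes "s \<in> S"
  shows "m (Tb s) (Tb s) = Tb \<one> + hsmult (lv - lvinv) (Tb s)"
proof -
  have s: "s \<in> carrier G" using assms S_carrier by blast
  have "0 = m (Tb s) (Tb s) + hsmult lvinv (Tb s) - (hsmult lv (Tb s) + Tb \<one>)"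
    using quadratic[OF assms] s by (simp add: m_bilinear m_Tb_one hs.scale_right_diff_distrib mult.commute[of lvinv] algebra_simps)
  then show ?thesis by (simp add: hs.scale_left_diff_distrib algebra_simps)
qed

lemma T_S_mult:
  assumes s: "s \<in> S" and x: "x \<in> carrier G"
  shows "\<exists>d\<in>H. m (Tb s) (Tb x) = Tb (s \<otimes> x) + hsmult pv d"
proof (cases "len (s \<otimes> x) = Suc (len x)")
  case True
  then have "m (Tb s) (Tb x) = Tb (s \<otimes> x)"
    using s x by (intro T_add) (auto simp: len_S S_carrier)
  then show ?thesis by (intro bexI[of _ 0]) auto
next
  case False
  then have len: "len x = Suc (len (s \<otimes> x))" using len_S_mult[OF s x] by simp
  have sG: "s \<in> carrier G" using s S_carrier by blast
  have ssx: "s \<otimes> (s \<otimes> x) = x" using sG x s by (simp add: m_assoc[symmetric] S_square)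
  have Tx: "m (Tb s) (Tb (s \<otimes> x)) = Tb x"
    using T_add[of s "s \<otimes> x"] sG x s len by (simp add: ssx len_S)
  \<comment> \<open>When \<open>sx\<close> is shorter, \<open>T_x = T_s T_{sx}\<close>, and the
    quadratic relation applies to the resulting square.\<close>
  have "m (Tb s) (Tb x) = m (m (Tb s) (Tb s)) (Tb (s \<otimes> x))"
    using sG x by (simp add: hm_assoc Tx)
  also have "\<dots> = Tb (s \<otimes> x) + hsmult pv (hsmult (lvinv * (lv + 1)) (Tb x))"
    using sG x s by (simp add: T_S_square m_bilinear m_Tb_one Tx lv_minus_lvinv del: hs.scale_left_diff_distrib)
  finally show ?thesis using x by (intro bexI[of _ "hsmult (lvinv * (lv + 1)) (Tb x)"]) auto
qed

text \<open>Peeling off left descents of \<open>x\<close> leaves one simple reflection at a time;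
  elements of length zero multiply exactly.\<close>

lemma T_mult_mod:
  assumes "x \<in> carrier G" "y \<in> carrier G"
  shows "\<exists>d\<in>H. m (Tb x) (Tb y) = Tb (x \<otimes> y) + hsmult pv d"
  using assms
proof (induction "len x" arbitrary: x)
  case 0
  then have "m (Tb x) (Tb y) = Tb (x \<otimes> y)" by (intro T_add) (auto simp: len_zero_mult)
  then show ?case by (intro bexI[of _ 0]) auto
next
  case (Suc n)
  obtain s where s: "s \<in> S" "len x = Suc (len (s \<otimes> x))" using descent[of x] Suc by auto
  have sG: "s \<in> carrier G" using s S_carrier by blast
  let ?x = "s \<otimes> x"
  have x': "?x \<in> carrier G" using sG Suc by simp
  have ssx: "s \<otimes> ?x = x" using sG Suc s by (simp add: m_assoc[symmetric] S_square)
  have ssxy: "s \<otimes> (?x \<otimes> y) = x \<otimes> y" using sG Suc s x' by (simp add: m_assoc[symmetric] S_square)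
  have Tx: "m (Tb s) (Tb ?x) = Tb x"
    using T_add[of s ?x] sG x' s by (simp add: ssx len_S)
  obtain d where d: "d \<in> H" "m (Tb ?x) (Tb y) = Tb (?x \<otimes> y) + hsmult pv d"
    using Suc.hyps(1)[of ?x] Suc x' s by auto
  obtain e where e: "e \<in> H" "m (Tb s) (Tb (?x \<otimes> y)) = Tb (x \<otimes> y) + hsmult pv e"
    using T_S_mult[OF s(1), of "?x \<otimes> y"] x' Suc ssxy by auto
  have "m (Tb x) (Tb y) = m (Tb s) (m (Tb ?x) (Tb y))"
    using sG x' Suc by (simp add: hm_assoc flip: Tx)
  also have "\<dots> = m (Tb s) (Tb (?x \<otimes> y)) + hsmult pv (m (Tb s) d)"
    using sG x' Suc d by (simp add: d(2) m_bilinear del: hs.scale_left_diff_distrib)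
  also have "\<dots> = Tb (x \<otimes> y) + hsmult pv (e + m (Tb s) d)"
    unfolding e(2) by (simp add: hs.scale_right_distrib del: hs.scale_left_diff_distrib)
  finally show ?case using e d sG by (intro bexI[of _ "e + m (Tb s) d"]) auto
qed

lemma T_invertible:
  assumes "x \<in> carrier G"
  shows "\<exists>y\<in>H. m (Tb x) y = Tb \<one> \<and> m y (Tb x) = Tb \<one>"
  using assms
proof (induction "len x" arbitrary: x)
  case 0
  then have "len (inv x) = 0" using len_zero_mult[of x "inv x"] by (simp add: len_one)
  then show ?case using 0 T_add[of x "inv x"] T_add[of "inv x" x]
    by (intro bexI[of _ "Tb (inv x)"]) (auto simp: len_one)
next
  case (Suc n)
  obtain s where s: "s \<in> S" "len x = Suc (len (s \<otimes> x))" using descent[of x] Suc by auto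
  have sG: "s \<in> carrier G" using s S_carrier by blast
  let ?x = "s \<otimes> x"
  have x': "?x \<in> carrier G" using sG Suc by simp
  have ssx: "s \<otimes> ?x = x" using sG Suc s by (simp add: m_assoc[symmetric] S_square)
  have Tx: "m (Tb s) (Tb ?x) = Tb x"
    using T_add[of s ?x] sG x' s by (simp add: ssx len_S)
  obtain y where y: "y \<in> H" "m (Tb ?x) y = Tb \<one>" "m y (Tb ?x) = Tb \<one>"
    using Suc.hyps(1)[of ?x] Suc x' s by auto
  \<comment> \<open>The inverse of \<open>T_s\<close>, read off from the quadratic relation.\<close>
  define t where "t = Tb s - hsmult (lv - lvinv) (Tb \<one>)"
  have t: "t \<in> H" "m (Tb s) t = Tb \<one>" "m t (Tb s) = Tb \<one>"
    using sG T_S_square[OF s(1)]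
    by (auto simp: t_def m_bilinear m_Tb_one simp del: hs.scale_left_diff_distrib)
  have "m (Tb x) (m y t) = m (Tb s) (m (m (Tb ?x) y) t)"
    using sG x' y(1) t(1) by (simp add: hm_assoc flip: Tx)
  then have 1: "m (Tb x) (m y t) = Tb \<one>" using y t by (simp add: m_Tb_one)
  have "m (m y t) (Tb x) = m y (m (m t (Tb s)) (Tb ?x))"
    using sG x' y(1) t(1) by (simp add: hm_assoc flip: Tx)
  then have 2: "m (m y t) (Tb x) = Tb \<one>" using y t x' by (simp add: m_Tb_one)
  show ?case using 1 2 y t by (intro bexI[of _ "m y t"]) auto
qed

text \<open>The inverse of \<open>T_x\<close>, multiplied into the congruence between
  \<open>T_x T_{x^{-1}}\<close> and \<open>1\<close>, identifies it at \<open>v = 1\<close>.\<close>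

lemma T_inverse_mod:
  assumes "x \<in> carrier G"
  shows "\<exists>y\<in>H. \<exists>d\<in>H. m (Tb x) y = Tb \<one> \<and> m y (Tb x) = Tb \<one> \<and> y = Tb (inv x) + hsmult pv d"
proof -
  obtain y where y: "y \<in> H" "m (Tb x) y = Tb \<one>" "m y (Tb x) = Tb \<one>"
    using T_invertible[OF assms] by blast
  obtain d where d: "d \<in> H" "m (Tb x) (Tb (inv x)) = Tb \<one> + hsmult pv d"
    using T_mult_mod[of x "inv x"] assms by auto
  have "Tb (inv x) = m (m y (Tb x)) (Tb (inv x))"
    using assms y by (simp add: m_Tb_one)
  also have "\<dots> = m y (Tb \<one> + hsmult pv d)"
    using assms y(1) by (simp add: hm_assoc d(2))
  also have "\<dots> = y + hsmult pv (m y d)"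
    using y(1) d(1) by (simp add: m_bilinear m_Tb_one del: hs.scale_left_diff_distrib)
  finally have "y = Tb (inv x) + hsmult pv (- m y d)" by (simp add: hs.scale_minus_right)
  moreover have "- m y d \<in> H" using y(1) d(1) by (intro hs.subspace_neg[OF subspace_hcarrier]) auto
  ultimately show ?thesis using y by blast
qed

lemma mult_mod:
  assumes "x \<in> carrier G" "y \<in> carrier G" "d \<in> H" "e \<in> H"
  shows "\<exists>f\<in>H. m (Tb x + hsmult pv d) (Tb y + hsmult pv e) = Tb (x \<otimes> y) + hsmult pv f"
proof -
  obtain f where f: "f \<in> H" "m (Tb x) (Tb y) = Tb (x \<otimes> y) + hsmult pv f"
    using T_mult_mod assms by blast
  have "m (Tb x + hsmult pv d) (Tb y + hsmult pv e)
    = Tb (x \<otimes> y) + hsmult pv (f + m d (Tb y) + m (Tb x) e + hsmult pv (m d e))"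
    using assms f
    by (simp add: m_bilinear hs.scale_right_distrib del: hs.scale_left_diff_distrib hs.scale_scale)
  moreover have "f + m d (Tb y) + m (Tb x) e + hsmult pv (m d e) \<in> H" using assms f by simp
  ultimately show ?thesis by blast
qed

text \<open>Length additivity gives \<open>T_g T_z = T_{gz} = T_{zg} = T_z T_g\<close>. Multiplying
  \<open>T_z\<close> by inverses of \<open>T_g\<close> keeps it commuting with \<open>T_g\<close>
  and at \<open>v = 1\<close> moves it to \<open>g^{-i} z\<close>.\<close>

lemma commuting_lift_straight:
  assumes g: "g \<in> carrier G" and z: "z \<in> carrier G" and comm: "g \<otimes> z = z \<otimes> g"
    and len: "len (g \<otimes> z) = len g + len z"
  shows "\<exists>b\<in>H. \<exists>d\<in>H. b = Tb ((inv g) [^] (i::nat) \<otimes> z) + hsmult pv d \<and> m (Tb g) b = m b (Tb g)"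
proof (induction i)
  case 0
  have "m (Tb g) (Tb z) = m (Tb z) (Tb g)"
    using T_add[of g z] T_add[of z g] g z comm len by simp
  then show ?case using z by (intro bexI[of _ "Tb z"] bexI[of _ 0]) auto
next
  case (Suc i)
  obtain b d where b: "b \<in> H" "d \<in> H" "b = Tb ((inv g) [^] i \<otimes> z) + hsmult pv d"
    "m (Tb g) b = m b (Tb g)" using Suc by blast
  obtain y e where y: "y \<in> H" "e \<in> H" "m (Tb g) y = Tb \<one>" "m y (Tb g) = Tb \<one>"
    "y = Tb (inv g) + hsmult pv e" using T_inverse_mod[OF g] by blast
  have eq: "inv g \<otimes> ((inv g) [^] i \<otimes> z) = (inv g) [^] Suc i \<otimes> z"
    using g z by (metis inv_closed m_assoc nat_pow_Suc2 nat_pow_closed)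
  obtain f where f: "f \<in> H" "m y b = Tb ((inv g) [^] Suc i \<otimes> z) + hsmult pv f"
    using mult_mod[of "inv g" "(inv g) [^] i \<otimes> z" e d] g z b(2) y(2) eq
    by (metis b(3) y(5) inv_closed m_closed nat_pow_closed)
  have gH: "Tb g \<in> H" using g by simp
  have "m (Tb g) (m y b) = b"
    using hm_assoc[OF gH y(1) b(1)] y(3) b(1) by (simp add: m_Tb_one)
  moreover have "m (m y b) (Tb g) = b"
    using hm_assoc[OF y(1) b(1) gH] hm_assoc[OF y(1) gH b(1)] y(4) b(1,4) by (simp add: m_Tb_one)
  ultimately have "m (Tb g) (m y b) = m (m y b) (Tb g)" by simp
  moreover have "m y b \<in> H" using y(1) b(1) by simp
  ultimately show ?case using f by blast
qed

sublocale deformed_group_algebra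
proof
  fix x y assume "x \<in> carrier G" "y \<in> carrier G"
  then show "\<exists>d\<in>H. m (Tb x) (Tb y) = Tb (x \<otimes> y) + hsmult pv d" by (rule T_mult_mod)
next
  fix x g assume x: "x \<in> carrier G" and g: "g \<in> carrier G" "g \<otimes> x = x \<otimes> g"
  obtain n j where n: "n > (0::nat)" and
    len: "len (g [^] n \<otimes> ((g [^] n) [^] (j::nat) \<otimes> x)) = len (g [^] n) + len ((g [^] n) [^] j \<otimes> x)"
    using straight[OF x g] by blast
  define h where "h = g [^] n"
  have h: "h \<in> carrier G" using g by (simp add: h_def)
  have hx: "h \<otimes> x = x \<otimes> h" unfolding h_def
    using x g by (induction n) (simp_all add: m_assoc, metis m_assoc nat_pow_closed)
  let ?z = "h [^] j \<otimes> x"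
  have z: "?z \<in> carrier G" using h x by simp
  have "h \<otimes> ?z = ?z \<otimes> h"
    using h x hx by (metis m_assoc nat_pow_Suc nat_pow_Suc2 nat_pow_closed)
  \<comment> \<open>The exponent \<open>j + 1\<close> takes \<open>z = h^j x\<close> back to
    \<open>h^{-1} x\<close>, the second factor in \<open>F h x\<close>.\<close>
  then obtain b d where b: "b \<in> H" "d \<in> H" "b = Tb ((inv h) [^] Suc j \<otimes> ?z) + hsmult pv d"
    "m (Tb h) b = m b (Tb h)"
    using commuting_lift_straight[OF h z, of "Suc j"] len by (auto simp: h_def)
  have "(inv h) [^] Suc j \<otimes> ?z = inv h \<otimes> ((inv h) [^] j \<otimes> (h [^] j \<otimes> x))"
    using h x by (metis inv_closed m_assoc m_closed nat_pow_Suc2 nat_pow_closed)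
  also have "(inv h) [^] j \<otimes> (h [^] j \<otimes> x) = x"
    using h x by (simp add: nat_pow_inv m_assoc[symmetric])
  finally show "\<exists>n>0. \<exists>b\<in>H. \<exists>d\<in>H. b = Tb (inv (g [^] (n::nat)) \<otimes> x) + hsmult pv d \<and>
         m (Tb (g [^] n)) b = m b (Tb (g [^] n))"
    using n b unfolding h_def by auto
qed

end

section \<open>The extended affine Weyl group\<close>

text \<open>The adjoint action on characters, a right action; \<open>tact u a\<close> is the root
  written \<open>u^{-1} a\<close> in the Iwahori--Matsumoto formula.\<close>

definition tact :: "int^'n^'n \<Rightarrow> int^'n \<Rightarrow> int^'n" where
  "tact M a = Finite_Cartesian_Product.transpose M *v a"

lemma tact_nth: "tact M a $ i = (\<Sum>j\<in>UNIV. M $ j $ i * a $ j)"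
  by (simp add: tact_def matrix_vector_mult_def Finite_Cartesian_Product.transpose_def del: transpose_matrix_vector)

lemma tact_mult: "tact (A ** B) a = tact B (tact A a)"
  by (simp only: tact_def matrix_transpose_mul matrix_vector_mul_assoc)

lemma tact_one [simp]: "tact (mat 1) a = a"
  by (simp add: tact_def del: transpose_matrix_vector)

lemma tact_minus: "tact M (- a) = - tact M a"
  by (simp add: vec_eq_iff tact_nth sum_negf)

lemma pairing_add_left: "pairing (x + y) a = pairing x a + pairing y a"
  and pairing_diff_left: "pairing (x - y) a = pairing x a - pairing y a"
  and pairing_scale_left: "pairing (c *s x) a = c * pairing x a"
  and pairing_minus_right: "pairing x (- a) = - pairing x a"
  and pairing_zero_left: "pairing 0 a = 0"
  by (simp_all add: pairing_def sum.distrib sum_subtractf sum_distrib_left sum_negf algebra_simps)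

lemma pairing_matrix: "pairing (M *v x) a = pairing x (tact M a)"
proof -
  have "pairing (M *v x) a = (\<Sum>i\<in>UNIV. \<Sum>j\<in>UNIV. M $ i $ j * x $ j * a $ i)"
    by (simp add: pairing_def matrix_vector_mult_def sum_distrib_right)
  also have "\<dots> = (\<Sum>j\<in>UNIV. \<Sum>i\<in>UNIV. M $ i $ j * x $ j * a $ i)"
    by (rule sum.swap)
  also have "\<dots> = pairing x (tact M a)"
    by (simp add: pairing_def tact_nth sum_distrib_left mult_ac)
  finally show ?thesis .
qed

lemma refl_mat_vec: "refl_mat cor a *v x = x - pairing x a *s cor a"
proof -
  have "(refl_mat cor a *v x) $ i = x $ i - pairing x a * cor a $ i" for i
  proof -
    have "(refl_mat cor a *v x) $ i = (\<Sum>j\<in>UNIV. (if i = j then x $ j else 0) - cor a $ i * (x $ j * a $ j))"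
      by (auto simp: refl_mat_def matrix_vector_mult_def algebra_simps intro!: sum.cong)
    also have "\<dots> = x $ i - cor a $ i * pairing x a"
      by (simp add: sum_subtractf pairing_def sum_distrib_left)
    finally show ?thesis by simp
  qed
  then show ?thesis by (simp add: vec_eq_iff)
qed

lemma tact_refl_mat: "tact (refl_mat cor a) b = b - pairing (cor a) b *s a"
proof -
  have "tact (refl_mat cor a) b $ i = b $ i - pairing (cor a) b * a $ i" for i
  proof -
    have "tact (refl_mat cor a) b $ i = (\<Sum>j\<in>UNIV. (if j = i then b $ j else 0) - cor a $ j * b $ j * a $ i)"
      by (auto simp: refl_mat_def tact_nth algebra_simps intro!: sum.cong)
    also have "\<dots> = b $ i - pairing (cor a) b * a $ i"
      by (simp add: sum_subtractf pairing_def sum_distrib_right)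
    finally show ?thesis by simp
  qed
  then show ?thesis by (simp add: vec_eq_iff)
qed

lemma rpairing_add_left: "rpairing (v + u) a = rpairing v a + rpairing u a"
  and rpairing_scaleR_left: "rpairing (c *\<^sub>R v) a = c * rpairing v a"
  and rpairing_minus_right: "rpairing v (- a) = - rpairing v a"
  and rpairing_diff_scale_right: "rpairing v (b - n *s a) = rpairing v b - of_int n * rpairing v a"
  by (simp_all add: rpairing_def sum.distrib sum_subtractf sum_distrib_left sum_negf algebra_simps)

lemma rpairing_axis: "rpairing (axis i 1) a = of_int (a $ i)"
proof -
  have "rpairing (axis i 1) a = (\<Sum>j\<in>UNIV. if j = i then of_int (a $ j) else 0)"
    unfolding rpairing_def by (rule sum.cong) (auto simp: axis_def)
  then show ?thesis by simp
qed

section \<open>Vectors off finitely many hyperplanes\<close>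

lemma eventually_at_right_affine_nonzero:
  fixes c d :: real
  assumes "d \<noteq> 0"
  shows "eventually (\<lambda>e. c + e * d \<noteq> 0) (at_right 0)"
proof -
  have "((\<lambda>e. c + e * d) \<longlongrightarrow> c + 0 * d) (at_right 0)"
    by (intro tendsto_intros)
  then have "c \<noteq> 0 \<Longrightarrow> eventually (\<lambda>e. c + e * d \<noteq> 0) (at_right 0)"
    by (intro tendsto_imp_eventually_ne) auto
  moreover have "eventually (\<lambda>e. c + e * d \<noteq> 0) (at_right 0)" if "c = 0"
    using that assms eventually_at_right_less[of 0] by (auto elim: eventually_mono)
  ultimately show ?thesis by blast
qed

text \<open>A small step in a direction outside the new kernel leaves that kernel without entering
  any of the earlier ones.\<close>

lemma ex_generic_vector:
  fixes L :: "'i \<Rightarrow> 'v::real_vector \<Rightarrow> real"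
  assumes "finite I" "\<And>i. i \<in> I \<Longrightarrow> linear (L i)" "\<And>i. i \<in> I \<Longrightarrow> \<exists>u. L i u \<noteq> 0"
  shows "\<exists>v. \<forall>i\<in>I. L i v \<noteq> 0"
  using assms
proof (induction I)
  case (insert k I)
  then obtain v where v: "\<forall>i\<in>I. L i v \<noteq> 0" by auto
  obtain u where u: "L k u \<noteq> 0" using insert.prems(2)[of k] by auto
  have val: "L i (v + e *\<^sub>R u) = L i v + e * L i u" if "i \<in> insert k I" for i e
    using insert.prems(1)[OF that] by (simp add: linear_add linear_scale)
  have "eventually (\<lambda>e. L i v + e * L i u \<noteq> 0) (at_right 0)" if "i \<in> insert k I" for i
  proof (cases "L i u = 0")
    case True
    then have "L i v \<noteq> 0" using v u that by auto
    then show ?thesis using True by simp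
  qed (rule eventually_at_right_affine_nonzero)
  then have "eventually (\<lambda>e. \<forall>i\<in>insert k I. L i v + e * L i u \<noteq> 0) (at_right 0)"
    using insert.hyps by (intro eventually_ball_finite) auto
  then obtain e where "\<forall>i\<in>insert k I. L i v + e * L i u \<noteq> 0"
    using eventually_happens'[OF trivial_limit_at_right_real] by fastforce
  then show ?case using val by (intro exI[of _ "v + e *\<^sub>R u"]) auto
qed auto

text \<open>The pair \<open>(a, k)\<close> stands for the affine function
  \<open>x \<mapsto> <x,a> + k\<close>, and \<open>act w\<close> is composition with the affine map
  \<open>w\<close>; hence a right action.\<close>

definition act :: "('n::finite) ewg \<Rightarrow> (int^'n) \<times> int \<Rightarrow> (int^'n) \<times> int" where
  "act w b = (tact (snd w) (fst b), snd b + pairing (fst w) (fst b))"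

lemma act_ew_mult: "act (ew_mult x y) b = act y (act x b)"
  by (simp add: act_def ew_mult_def tact_mult pairing_add_left pairing_matrix)

lemma act_ew_one [simp]: "act ew_one b = b"
  by (simp add: act_def ew_one_def pairing_zero_left)

lemma ew_mult_assoc: "ew_mult (ew_mult x y) z = ew_mult x (ew_mult y z)"
  by (simp add: ew_mult_def matrix_mul_assoc matrix_vector_mul_assoc matrix_vector_right_distrib)

locale based_root_datum =
  fixes Phi :: "(int^'n) set" and cor pos and Om :: "(int^'n^'n) set"
  assumes rd: "root_datum Phi cor" and reduced: "reduced_rd Phi"
    and ps: "positive_system Phi pos" and dg: "diagram_group Phi cor pos Om"
begin

section \<open>Roots, the fundamental alcove and the group structure\<close>

lemma finite_Phi: "finite Phi"
  and pairing_cor: "a \<in> Phi \<Longrightarrow> pairing (cor a) a = 2"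
  and refl_Phi: "a \<in> Phi \<Longrightarrow> b \<in> Phi \<Longrightarrow> b - pairing (cor a) b *s a \<in> Phi"
  using rd by (auto simp: root_datum_def)

lemma uminus_Phi: "a \<in> Phi \<Longrightarrow> - a \<in> Phi"
proof -
  assume a: "a \<in> Phi"
  have "a - 2 *s a = - a" by (simp add: vec_eq_iff)
  then show ?thesis using refl_Phi[OF a a] unfolding pairing_cor[OF a] by (simp only:)
qed

lemma uminus_Phi_iff: "- a \<in> Phi \<longleftrightarrow> a \<in> Phi"
  using uminus_Phi[of a] uminus_Phi[of "- a"] by auto

lemma pos_subset: "pos \<subseteq> Phi" and finite_pos: "finite pos"
  and uminus_pos_iff: "a \<in> Phi \<Longrightarrow> - a \<in> pos \<longleftrightarrow> a \<notin> pos"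
proof -
  obtain f where f: "\<forall>a\<in>Phi. rpairing f a \<noteq> 0" "pos = {a \<in> Phi. rpairing f a > 0}"
    using ps by (auto simp: positive_system_def)
  then show "pos \<subseteq> Phi" by auto
  then show "finite pos" using finite_Phi finite_subset by blast
  show "a \<in> Phi \<Longrightarrow> - a \<in> pos \<longleftrightarrow> a \<notin> pos"
    using f by (force simp: rpairing_minus_right uminus_Phi_iff)
qed

abbreviation "alcove_point v \<equiv> \<forall>a\<in>pos. 0 < rpairing v a \<and> rpairing v a < 1"

text \<open>The functional that defines the positive system is a point of the dominant chamber;
  scaling it down brings it into the alcove.\<close>

lemma ex_alcove_point: "\<exists>v. alcove_point v"
proof -
  obtain f where f: "pos = {a \<in> Phi. rpairing f a > 0}"
    using ps by (auto simp: positive_system_def)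
  have "eventually (\<lambda>e. 0 < e * rpairing f a \<and> e * rpairing f a < 1) (at_right 0)" if "a \<in> pos" for a
  proof -
    have "((\<lambda>e. e * rpairing f a) \<longlongrightarrow> 0 * rpairing f a) (at_right 0)" by (intro tendsto_intros)
    then have "eventually (\<lambda>e. e * rpairing f a < 1) (at_right 0)"
      by (intro order_tendstoD) auto
    moreover have "eventually (\<lambda>e. 0 < e * rpairing f a) (at_right 0)"
      using that f eventually_at_right_less[of 0] by (auto elim: eventually_mono)
    ultimately show ?thesis by eventually_elim simp
  qed
  then have "eventually (\<lambda>e. \<forall>a\<in>pos. 0 < e * rpairing f a \<and> e * rpairing f a < 1) (at_right 0)"
    using finite_pos by (intro eventually_ball_finite) auto
  then obtain e where "\<forall>a\<in>pos. 0 < e * rpairing f a \<and> e * rpairing f a < 1"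
    using eventually_happens'[OF trivial_limit_at_right_real] by fastforce
  then show ?thesis by (intro exI[of _ "e *\<^sub>R f"]) (simp add: rpairing_scaleR_left)
qed

lemma Om_one: "mat 1 \<in> Om" and Om_mult: "p \<in> Om \<Longrightarrow> q \<in> Om \<Longrightarrow> p ** q \<in> Om"
  and Om_aut: "p \<in> Om \<Longrightarrow> diagram_aut Phi cor pos p"
  using dg by (auto simp: diagram_group_def)

lemma Om_inverse:
  assumes "p \<in> Om"
  shows "\<exists>q\<in>Om. p ** q = mat 1 \<and> q ** p = mat 1"
proof -
  obtain q where q: "q \<in> Om" "p ** q = mat 1" using dg assms by (auto simp: diagram_group_def)
  obtain p' where p': "p' \<in> Om" "q ** p' = mat 1" using dg q by (auto simp: diagram_group_def)
  have "p = p ** (q ** p')" using p' by simp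
  also have "\<dots> = p'" using q by (simp add: matrix_mul_assoc)
  finally show ?thesis using q p' by auto
qed

lemma refl_mat_weyl0: "a \<in> Phi \<Longrightarrow> refl_mat cor a \<in> weyl0 Phi cor"
  using weyl0.refl[OF _ weyl0.one, of a Phi cor] by simp

lemma weyl0_mult: "w \<in> weyl0 Phi cor \<Longrightarrow> w' \<in> weyl0 Phi cor \<Longrightarrow> w ** w' \<in> weyl0 Phi cor"
  by (induction rule: weyl0.induct) (auto simp: matrix_mul_assoc[symmetric] intro: weyl0.refl)

lemma refl_mat_square: "a \<in> Phi \<Longrightarrow> refl_mat cor a ** refl_mat cor a = mat 1"
  unfolding matrix_eq by (simp add: matrix_vector_mul_assoc[symmetric] refl_mat_vec pairing_diff_left
      pairing_scale_left pairing_cor vec_eq_iff algebra_simps)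

lemma weyl0_inverse:
  "w \<in> weyl0 Phi cor \<Longrightarrow> \<exists>w'\<in>weyl0 Phi cor. w ** w' = mat 1 \<and> w' ** w = mat 1"
proof (induction rule: weyl0.induct)
  case one
  then show ?case using weyl0.one by (intro bexI[of _ "mat 1"]) auto
next
  case (refl a M)
  then obtain w' where w': "w' \<in> weyl0 Phi cor" "M ** w' = mat 1" "w' ** M = mat 1" by blast
  let ?s = "refl_mat cor a"
  have "?s ** M ** (w' ** ?s) = ?s ** (M ** w') ** ?s" "w' ** ?s ** (?s ** M) = w' ** (?s ** ?s) ** M"
    by (simp_all only: matrix_mul_assoc)
  then show ?case using w' refl refl_mat_square[of a]
    by (intro bexI[of _ "w' ** ?s"]) (auto intro: weyl0_mult refl_mat_weyl0)
qed

text \<open>A diagram automorphism conjugates the reflection of a root to that of the corresponding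
  root, so \<open>Om\<close> normalizes the finite Weyl group.\<close>

lemma Om_weyl0_commute:
  assumes p: "p \<in> Om"
  shows "w \<in> weyl0 Phi cor \<Longrightarrow> \<exists>w'\<in>weyl0 Phi cor. p ** w = w' ** p"
proof (induction rule: weyl0.induct)
  case one
  then show ?case using weyl0.one by (intro bexI[of _ "mat 1"]) auto
next
  case (refl a M)
  then obtain w' where w': "w' \<in> weyl0 Phi cor" "p ** M = w' ** p" by blast
  obtain b where b: "b \<in> Phi" "tact p b = a" "p *v cor a = cor b"
    using Om_aut[OF p] refl by (auto simp: diagram_aut_def tact_def simp del: transpose_matrix_vector)
  have scale: "p *v (c *s x) = c *s (p *v x)" for c x
    by (simp add: matrix_vector_mult_def vec_eq_iff sum_distrib_left mult_ac)
  have "p ** refl_mat cor a = refl_mat cor b ** p"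
    unfolding matrix_eq by (simp add: matrix_vector_mul_assoc[symmetric] refl_mat_vec pairing_matrix b
        matrix_vector_mult_diff_distrib scale)
  then have "p ** (refl_mat cor a ** M) = (refl_mat cor b ** w') ** p"
    using w' by (metis matrix_mul_assoc)
  then show ?case using w' b weyl0.refl by blast
qed

definition ewG :: "'n ewg monoid" where
  "ewG = \<lparr>carrier = ext_weyl Phi cor Om, monoid.mult = ew_mult, one = ew_one\<rparr>"

lemma ewG_simps [simp]: "carrier ewG = ext_weyl Phi cor Om" "monoid.mult ewG = ew_mult" "one ewG = ew_one"
  by (auto simp: ewG_def)

lemma ext_weyl_iff: "x \<in> ext_weyl Phi cor Om \<longleftrightarrow> (\<exists>w\<in>weyl0 Phi cor. \<exists>p\<in>Om. snd x = w ** p)"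
  by (cases x) (auto simp: ext_weyl_def)

lemma group_ewG: "group ewG"
proof (rule groupI)
  fix x y assume "x \<in> carrier ewG" "y \<in> carrier ewG"
  then obtain w p w' p' where *: "w \<in> weyl0 Phi cor" "p \<in> Om" "snd x = w ** p"
    "w' \<in> weyl0 Phi cor" "p' \<in> Om" "snd y = w' ** p'" by (auto simp: ext_weyl_iff)
  then obtain w'' where w'': "w'' \<in> weyl0 Phi cor" "p ** w' = w'' ** p" using Om_weyl0_commute by blast
  have "snd (ew_mult x y) = w ** (p ** w') ** p'" using * by (simp add: ew_mult_def matrix_mul_assoc)
  also have "\<dots> = (w ** w'') ** (p ** p')" by (simp add: w'' matrix_mul_assoc)
  finally show "x \<otimes>\<^bsub>ewG\<^esub> y \<in> carrier ewG" using * w'' weyl0_mult Om_mult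
    unfolding ewG_simps ext_weyl_iff by blast
next
  show "\<one>\<^bsub>ewG\<^esub> \<in> carrier ewG"
    using weyl0.one Om_one unfolding ewG_simps ext_weyl_iff ew_one_def by force
next
  fix x y z show "x \<otimes>\<^bsub>ewG\<^esub> y \<otimes>\<^bsub>ewG\<^esub> z = x \<otimes>\<^bsub>ewG\<^esub> (y \<otimes>\<^bsub>ewG\<^esub> z)"
    by (simp add: ew_mult_assoc)
next
  fix x show "\<one>\<^bsub>ewG\<^esub> \<otimes>\<^bsub>ewG\<^esub> x = x" by (simp add: ew_mult_def ew_one_def)
next
  fix x assume "x \<in> carrier ewG"
  then obtain w p where *: "w \<in> weyl0 Phi cor" "p \<in> Om" "snd x = w ** p" by (auto simp: ext_weyl_iff)
  obtain w' where w': "w' \<in> weyl0 Phi cor" "w' ** w = mat 1" using weyl0_inverse * by blast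
  obtain p' where p': "p' \<in> Om" "p' ** p = mat 1" using Om_inverse * by blast
  obtain w'' where w'': "w'' \<in> weyl0 Phi cor" "p' ** w' = w'' ** p'" using Om_weyl0_commute p' w' by blast
  have "p' ** w' ** snd x = p' ** (w' ** w) ** p" using * by (simp add: matrix_mul_assoc)
  then have inv: "p' ** w' ** snd x = mat 1" using w' p' by simp
  have "ew_mult (- (p' ** w' *v fst x), p' ** w') x = ew_one"
    using inv by (simp add: ew_mult_def ew_one_def)
  moreover have "(- (p' ** w' *v fst x), p' ** w') \<in> ext_weyl Phi cor Om"
    using w'' p' by (auto simp: ext_weyl_iff)
  ultimately show "\<exists>y\<in>carrier ewG. y \<otimes>\<^bsub>ewG\<^esub> x = \<one>\<^bsub>ewG\<^esub>" by auto
qed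

lemma tact_Phi:
  assumes "x \<in> ext_weyl Phi cor Om" "a \<in> Phi"
  shows "tact (snd x) a \<in> Phi"
proof -
  have w: "tact w a \<in> Phi" if "w \<in> weyl0 Phi cor" "a \<in> Phi" for w a
    using that by (induction arbitrary: a rule: weyl0.induct) (auto simp: tact_mult tact_refl_mat refl_Phi)
  have p: "tact p a \<in> Phi" if p: "p \<in> Om" and a: "a \<in> Phi" for p a
  proof -
    \<comment> \<open>A diagram automorphism is specified by preimages of roots; finiteness of
      \<open>Phi\<close> turns this inclusion into invariance.\<close>
    have "Phi \<subseteq> tact p ` Phi"
    proof
      fix a assume "a \<in> Phi"
      then obtain b where "b \<in> Phi" "tact p b = a"
        using Om_aut[OF p] unfolding diagram_aut_def tact_def by blast
      then show "a \<in> tact p ` Phi" by blast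
    qed
    then have "Phi = tact p ` Phi"
      using finite_Phi by (intro card_seteq) (auto intro: card_image_le)
    then show ?thesis using a by blast
  qed
  obtain u q where "u \<in> weyl0 Phi cor" "q \<in> Om" "snd x = u ** q"
    using assms by (auto simp: ext_weyl_iff)
  then show ?thesis using p[OF _ w] assms(2) by (simp add: tact_mult)
qed


section \<open>Affine roots and the length function\<close>

abbreviation aff_roots :: "((int^'n) \<times> int) set" where "aff_roots \<equiv> Phi \<times> UNIV"

text \<open>The affine roots that are positive on the fundamental alcove. There a negative root
  takes values strictly between -1 and 0, hence the bound 1.\<close>

definition apos :: "((int^'n) \<times> int) set" where
  "apos = {(a, k). a \<in> Phi \<and> (if a \<in> pos then 0 \<le> k else 1 \<le> k)}"

definition neg :: "(int^'n) \<times> int \<Rightarrow> (int^'n) \<times> int" where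
  "neg b = (- fst b, - snd b)"

text \<open>These affine roots are positive on the fundamental alcove and negative on its image
  under \<open>w\<close>: the hyperplanes separating the two.\<close>

definition inversions :: "'n ewg \<Rightarrow> ((int^'n) \<times> int) set" where
  "inversions w = {b \<in> apos. act w b \<notin> apos}"

definition ev :: "real^'n \<Rightarrow> (int^'n) \<times> int \<Rightarrow> real" where
  "ev v b = rpairing v (fst b) + of_int (snd b)"

text \<open>The affine reflection \<open>x \<mapsto> x - (<x,a> + k) cor a\<close> in the zero set
  of \<open>b = (a, k)\<close>.\<close>

definition srefl :: "(int^'n) \<times> int \<Rightarrow> 'n ewg" where
  "srefl b = ((- snd b) *s cor (fst b), refl_mat cor (fst b))"

lemma apos_subset: "apos \<subseteq> aff_roots"
  by (auto simp: apos_def)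

text \<open>No affine root vanishes inside the alcove, so its sign at one point decides.\<close>

lemma apos_iff_ev:
  assumes "alcove_point v" "b \<in> aff_roots"
  shows "b \<in> apos \<longleftrightarrow> ev v b > 0" and "b \<notin> apos \<longleftrightarrow> ev v b < 0"
proof -
  obtain a k where b: "b = (a, k)" "a \<in> Phi" using assms by auto
  have "(b \<in> apos \<longrightarrow> ev v b > 0) \<and> (b \<notin> apos \<longrightarrow> ev v b < 0)"
  proof (cases "a \<in> pos")
    case True
    then have a: "0 < rpairing v a" "rpairing v a < 1" using assms by auto
    have "k < 0 \<Longrightarrow> real_of_int k \<le> - 1" by linarith
    then show ?thesis using True a b by (auto simp: apos_def ev_def)
  next
    case False
    then have "- a \<in> pos" using uminus_pos_iff b by blast
    then have a: "0 < rpairing v (- a)" "rpairing v (- a) < 1" using assms by blast+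
    have "k < 1 \<Longrightarrow> real_of_int k \<le> 0" "1 \<le> k \<Longrightarrow> 1 \<le> real_of_int k" by linarith+
    then show ?thesis using False a b by (auto simp: apos_def ev_def rpairing_minus_right not_le)
  qed
  then show "b \<in> apos \<longleftrightarrow> ev v b > 0" "b \<notin> apos \<longleftrightarrow> ev v b < 0" by auto
qed

lemma neg_apos: "b \<in> aff_roots \<Longrightarrow> neg b \<in> apos \<longleftrightarrow> b \<notin> apos"
  by (auto simp: neg_def apos_def uminus_Phi uminus_pos_iff)

lemma act_neg: "act w (neg b) = neg (act w b)"
  by (simp add: act_def neg_def tact_minus pairing_minus_right)

lemma act_aff_roots: "w \<in> ext_weyl Phi cor Om \<Longrightarrow> b \<in> aff_roots \<Longrightarrow> act w b \<in> aff_roots"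
  by (auto simp: act_def tact_Phi)

text \<open>The signed summand of the Iwahori--Matsumoto formula; its sign tells whether the
  inversions parallel to \<open>a\<close> have gradient \<open>a\<close> or
  \<open>-a\<close>.\<close>

definition shift :: "'n ewg \<Rightarrow> int^'n \<Rightarrow> int" where
  "shift w a = (if tact (snd w) a \<in> pos then pairing (fst w) a else pairing (fst w) a - 1)"

lemma ew_len_eq_sum_shift: "ew_len pos w = (\<Sum>a\<in>pos. nat \<bar>shift w a\<bar>)"
proof -
  have "ew_len pos w = nat (\<Sum>a\<in>pos. \<bar>shift w a\<bar>)"
    unfolding ew_len_def shift_def tact_def by (intro arg_cong[of _ _ nat] sum.cong) auto
  also have "(\<Sum>a\<in>pos. \<bar>shift w a\<bar>) = int (\<Sum>a\<in>pos. nat \<bar>shift w a\<bar>)"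
    by simp
  finally show ?thesis by (simp only: nat_int)
qed

text \<open>For \<open>a\<close> positive, \<open>(a, k)\<close> with \<open>k \<ge> 0\<close> is
  inverted iff \<open>k + shift w a < 0\<close>, and \<open>(-a, k)\<close> with
  \<open>k \<ge> 1\<close> iff \<open>k \<le> shift w a\<close>; the -1 in \<open>shift\<close>
  absorbs the sign of the image root.\<close>

lemma inversions_eq:
  assumes w: "w \<in> ext_weyl Phi cor Om"
  shows "inversions w = (\<Union>a\<in>pos. Pair a ` {0..<- shift w a} \<union> Pair (- a) ` {1..shift w a})"
    (is "_ = ?U")
proof (rule Set.set_eqI)
  fix b :: "(int^'n) \<times> int"
  obtain a k where b: "b = (a, k)" by fastforce
  show "b \<in> inversions w \<longleftrightarrow> b \<in> ?U"
  proof (cases "a \<in> Phi")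
    case False
    then have "a \<notin> pos" "- a \<notin> pos" using pos_subset uminus_Phi_iff by auto
    moreover have "b \<in> ?U \<Longrightarrow> a \<in> pos \<or> - a \<in> pos" using b by auto
    ultimately show ?thesis using False b by (auto simp: inversions_def apos_def)
  next
    case a: True
    have t: "tact (snd w) a \<in> Phi" using w a by (rule tact_Phi)
    have U: "b \<in> ?U \<longleftrightarrow> (a \<in> pos \<and> 0 \<le> k \<and> k < - shift w a) \<or> (- a \<in> pos \<and> 1 \<le> k \<and> k \<le> shift w (- a))"
    proof
      assume "b \<in> ?U"
      then show "(a \<in> pos \<and> 0 \<le> k \<and> k < - shift w a) \<or> (- a \<in> pos \<and> 1 \<le> k \<and> k \<le> shift w (- a))"
        using b by auto
    next
      assume "(a \<in> pos \<and> 0 \<le> k \<and> k < - shift w a) \<or> (- a \<in> pos \<and> 1 \<le> k \<and> k \<le> shift w (- a))"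
      then show "b \<in> ?U"
      proof
        assume "a \<in> pos \<and> 0 \<le> k \<and> k < - shift w a"
        then show ?thesis using b by (intro UN_I[of a]) auto
      next
        assume "- a \<in> pos \<and> 1 \<le> k \<and> k \<le> shift w (- a)"
        then show ?thesis using b by (intro UN_I[of "- a"]) auto
      qed
    qed
    show ?thesis
    proof (cases "a \<in> pos")
      case True
      then have "- a \<notin> pos" using uminus_pos_iff a by blast
      then show ?thesis unfolding U using True a b t
        by (auto simp: inversions_def apos_def act_def shift_def)
    next
      case False
      then have ma: "- a \<in> pos" using uminus_pos_iff a by blast
      have "shift w (- a) = (if tact (snd w) a \<in> pos then - pairing (fst w) a - 1 else - pairing (fst w) a)"
        using uminus_pos_iff[OF t] by (simp add: shift_def tact_minus pairing_minus_right)
      then show ?thesis unfolding U using False ma a b t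
        by (auto simp: inversions_def apos_def act_def)
    qed
  qed
qed

text \<open>The pieces of \<open>inversions_eq\<close> are disjoint for different positive roots,
  and of the two intervals in a piece at most one is nonempty.\<close>

lemma
  assumes w: "w \<in> ext_weyl Phi cor Om"
  shows finite_inversions: "finite (inversions w)"
    and ew_len_eq_card: "ew_len pos w = card (inversions w)"
proof -
  let ?B = "\<lambda>a. Pair a ` {0..<- shift w a} \<union> Pair (- a) ` {1..shift w a}"
  show "finite (inversions w)" unfolding inversions_eq[OF w] using finite_pos by blast
  have disj: "?B a \<inter> ?B a' = {}" if "a \<in> pos" "a' \<in> pos" "a \<noteq> a'" for a a'
  proof -
    have "a \<noteq> - a'" using that uminus_pos_iff[of a'] pos_subset by blast
    moreover from this have "- a \<noteq> a'" by (metis minus_minus)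
    ultimately show ?thesis using that by auto
  qed
  have card: "card (?B a) = nat \<bar>shift w a\<bar>" if "a \<in> pos" for a
  proof -
    have "a \<noteq> - a" using that uminus_pos_iff[of a] pos_subset by (metis subsetD)
    then have "card (?B a) = card (Pair a ` {0..<- shift w a}) + card (Pair (- a) ` {1..shift w a})"
      by (intro card_Un_disjoint) auto
    also have "\<dots> = nat (- shift w a) + nat (shift w a)"
      by (simp add: card_image inj_on_def)
    finally show ?thesis by simp
  qed
  have "card (inversions w) = (\<Sum>a\<in>pos. card (?B a))"
    unfolding inversions_eq[OF w] by (rule card_UN_disjoint) (use finite_pos disj in auto)
  then show "ew_len pos w = card (inversions w)"
    unfolding ew_len_eq_sum_shift using card by simp
qed

lemma act_bij:
  assumes w: "w \<in> ext_weyl Phi cor Om"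
  shows "bij_betw (act w) aff_roots aff_roots"
proof -
  interpret group ewG by (rule group_ewG)
  let ?v = "inv\<^bsub>ewG\<^esub> w"
  have v: "?v \<in> ext_weyl Phi cor Om" using inv_closed[of w] w by simp
  have "ew_mult ?v w = ew_one" "ew_mult w ?v = ew_one" using w l_inv[of w] r_inv[of w] by auto
  then have "act ?v (act w b) = b" "act w (act ?v b) = b" for b
    by (metis act_ew_mult act_ew_one)+
  moreover have "act w ` aff_roots \<subseteq> aff_roots" "act ?v ` aff_roots \<subseteq> aff_roots"
    using act_aff_roots[OF w] act_aff_roots[OF v] by blast+
  ultimately show ?thesis
    by (intro bij_betw_byWitness[where f' = "act ?v"]) auto
qed

text \<open>An element without inversions permutes the positive affine roots, so it carries the
  inversions of \<open>xy\<close> bijectively to those of \<open>y\<close>.\<close>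

lemma ew_len_zero_mult:
  assumes x: "x \<in> ext_weyl Phi cor Om" and y: "y \<in> ext_weyl Phi cor Om" and "ew_len pos x = 0"
  shows "ew_len pos (ew_mult x y) = ew_len pos y"
proof -
  interpret group ewG by (rule group_ewG)
  have xy: "ew_mult x y \<in> ext_weyl Phi cor Om" using m_closed[of x y] x y by simp
  have "inversions x = {}" using assms ew_len_eq_card finite_inversions by simp
  then have 1: "act x b \<in> apos" if "b \<in> apos" for b using that unfolding inversions_def by blast
  have 2: "b \<in> apos" if "b \<in> aff_roots" "act x b \<in> apos" for b
    using 1[of "neg b"] that neg_apos[of b] neg_apos[of "act x b"] act_aff_roots[OF x that(1)]
    by (auto simp: act_neg)
  have "act x ` inversions (ew_mult x y) = inversions y"
  proof (intro equalityI subsetI)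
    fix b assume "b \<in> act x ` inversions (ew_mult x y)"
    then show "b \<in> inversions y" using 1 by (auto simp: inversions_def act_ew_mult)
  next
    fix b assume b: "b \<in> inversions y"
    then have "b \<in> aff_roots" using apos_subset by (auto simp: inversions_def)
    then obtain c where c: "c \<in> aff_roots" "b = act x c"
      using act_bij[OF x] unfolding bij_betw_def by blast
    then have "c \<in> inversions (ew_mult x y)"
      using b 2[of c] by (auto simp: inversions_def act_ew_mult)
    then show "b \<in> act x ` inversions (ew_mult x y)" using c by blast
  qed
  moreover have "inj_on (act x) (inversions (ew_mult x y))"
    using act_bij[OF x] apos_subset unfolding bij_betw_def inversions_def
    by (auto intro: inj_on_subset)
  ultimately have "card (inversions (ew_mult x y)) = card (inversions y)"
    by (metis card_image)
  then show ?thesis using ew_len_eq_card xy y by simp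
qed

section \<open>Simple affine reflections and the change of length\<close>

lemma srefl_ext_weyl: "b \<in> aff_roots \<Longrightarrow> srefl b \<in> ext_weyl Phi cor Om"
  unfolding ext_weyl_iff srefl_def
  by (rule bexI[of _ "refl_mat cor (fst b)"], rule bexI[of _ "mat 1"]) (auto simp: Om_one refl_mat_weyl0)

lemma cor_multiple_coroot_lattice:
  assumes "a \<in> Phi"
  shows "k *s cor a \<in> coroot_lattice Phi cor"
proof (induction k rule: int_induct[of _ 0])
  case base
  then show ?case using coroot_lattice.zero by (simp add: vec_eq_iff zero_vec_def[symmetric])
next
  case (step1 i)
  have "(i + 1) *s cor a = i *s cor a + cor a" by (simp add: vec_eq_iff algebra_simps)
  then show ?case using coroot_lattice.add[OF assms step1(2)] by (simp only:)
next
  case (step2 i)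
  have "(i - 1) *s cor a = i *s cor a - cor a" by (simp add: vec_eq_iff algebra_simps)
  then show ?case using coroot_lattice.sub[OF assms step2(2)] by (simp only:)
qed

lemma srefl_aff_weyl: "b \<in> aff_roots \<Longrightarrow> srefl b \<in> aff_weyl Phi cor"
  using cor_multiple_coroot_lattice[of "fst b" "- snd b"] refl_mat_weyl0[of "fst b"]
  by (auto simp: srefl_def aff_weyl_def)

lemma act_srefl:
  "act (srefl b) c = (fst c - pairing (cor (fst b)) (fst c) *s fst b, snd c - pairing (cor (fst b)) (fst c) * snd b)"
  unfolding act_def srefl_def fst_conv snd_conv tact_refl_mat pairing_scale_left by (simp add: mult.commute)

lemma act_srefl_self: "b \<in> aff_roots \<Longrightarrow> act (srefl b) b = neg b"
  by (auto simp: act_srefl neg_def pairing_cor vec_eq_iff)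

lemma srefl_square:
  assumes "b \<in> aff_roots"
  shows "ew_mult (srefl b) (srefl b) = ew_one"
proof -
  have a: "fst b \<in> Phi" using assms by auto
  have "(- snd b) *s cor (fst b) + refl_mat cor (fst b) *v ((- snd b) *s cor (fst b)) = 0"
    unfolding refl_mat_vec pairing_scale_left pairing_cor[OF a] by (simp add: vec_eq_iff)
  then show ?thesis
    using refl_mat_square[OF a] by (simp add: ew_mult_def ew_one_def srefl_def)
qed

text \<open>Simplicity is expressed through the inversion set of the reflection, so that no list of
  the walls of the alcove is required.\<close>

definition simple :: "((int^'n) \<times> int) set" where
  "simple = {b \<in> aff_roots. inversions (srefl b) = {b}}"

text \<open>The reflection permutes the positive affine roots other than \<open>b\<close>, which
  matches the inversions of \<open>x\<close> and \<open>sx\<close> away from \<open>b\<close>; since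
  it negates \<open>b\<close>, exactly one of the two elements inverts \<open>b\<close>.\<close>

lemma ew_len_srefl_mult:
  assumes b: "b \<in> simple" and x: "x \<in> ext_weyl Phi cor Om"
  shows "if b \<in> inversions x then ew_len pos x = Suc (ew_len pos (ew_mult (srefl b) x))
         else ew_len pos (ew_mult (srefl b) x) = Suc (ew_len pos x)"
proof -
  interpret group ewG by (rule group_ewG)
  let ?s = "srefl b"
  have bA: "b \<in> aff_roots" and bi: "inversions ?s = {b}" using b by (auto simp: simple_def)
  have bp: "b \<in> apos" using bi by (auto simp: inversions_def)
  have s: "?s \<in> ext_weyl Phi cor Om" using bA by (rule srefl_ext_weyl)
  have sx: "ew_mult ?s x \<in> ext_weyl Phi cor Om" using m_closed[of ?s x] s x by simp
  have ss: "act ?s (act ?s c) = c" for c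
    using srefl_square[OF bA] by (metis act_ew_mult act_ew_one)
  have sb: "act ?s b = neg b" using bA by (rule act_srefl_self)
  have pos: "act ?s c \<in> apos - {b}" if "c \<in> apos - {b}" for c
  proof -
    have "act ?s c \<in> apos" using that bi by (auto simp: inversions_def)
    moreover have "act ?s c \<noteq> b"
    proof
      assume "act ?s c = b"
      then have "c = neg b" using ss[of c] sb by simp
      then show False using that neg_apos[OF bA] bp by simp
    qed
    ultimately show ?thesis by simp
  qed
  have "bij_betw (act ?s) (inversions (ew_mult ?s x) - {b}) (inversions x - {b})"
  proof (rule bij_betw_byWitness[where f' = "act ?s"])
    show "act ?s ` (inversions (ew_mult ?s x) - {b}) \<subseteq> inversions x - {b}"
    proof (rule image_subsetI)
      fix c assume "c \<in> inversions (ew_mult ?s x) - {b}"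
      then show "act ?s c \<in> inversions x - {b}"
        using pos[of c] unfolding inversions_def act_ew_mult by blast
    qed
    show "act ?s ` (inversions x - {b}) \<subseteq> inversions (ew_mult ?s x) - {b}"
    proof (rule image_subsetI)
      fix c assume "c \<in> inversions x - {b}"
      then show "act ?s c \<in> inversions (ew_mult ?s x) - {b}"
        using pos[of c] ss[of c] unfolding inversions_def act_ew_mult by auto
    qed
  qed (auto simp: ss)
  then have card: "card (inversions (ew_mult ?s x) - {b}) = card (inversions x - {b})"
    by (rule bij_betw_same_card)
  have mem: "b \<in> inversions (ew_mult ?s x) \<longleftrightarrow> b \<notin> inversions x"
    using bp neg_apos[OF act_aff_roots[OF x bA]] by (simp add: inversions_def act_ew_mult sb act_neg)
  show ?thesis
  proof (cases "b \<in> inversions x")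
    case True
    have "inversions (ew_mult ?s x) - {b} = inversions (ew_mult ?s x)" using mem True by blast
    moreover have "card (inversions x) = Suc (card (inversions x - {b}))"
      by (rule card.remove[OF finite_inversions[OF x] True])
    ultimately show ?thesis using True
      unfolding ew_len_eq_card[OF x] ew_len_eq_card[OF sx] card[symmetric] by (simp only: if_True)
  next
    case False
    then have "b \<in> inversions (ew_mult ?s x)" using mem by blast
    then have "card (inversions (ew_mult ?s x)) = Suc (card (inversions (ew_mult ?s x) - {b}))"
      by (rule card.remove[OF finite_inversions[OF sx]])
    moreover have "inversions x - {b} = inversions x" using False by blast
    ultimately show ?thesis using False
      unfolding ew_len_eq_card[OF x] ew_len_eq_card[OF sx] card by (simp only: if_False)
  qed
qed

lemma ew_len_srefl: "b \<in> simple \<Longrightarrow> ew_len pos (srefl b) = 1"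
  using ew_len_eq_card srefl_ext_weyl by (auto simp: simple_def)

lemma srefl_simple_refls: "b \<in> simple \<Longrightarrow> srefl b \<in> simple_refls Phi cor pos"
  using ew_len_srefl srefl_aff_weyl by (auto simp: simple_refls_def simple_def)

text \<open>As an affine function the reflected root is \<open>c\<close> minus a multiple of
  \<open>b\<close>; composition with \<open>w\<close> and evaluation at \<open>v\<close> are
  linear.\<close>

lemma ev_act_srefl: "ev v (act w (act (srefl b) c)) = ev v (act w c) - of_int (pairing (cor (fst b)) (fst c)) * ev v (act w b)"
proof -
  have 1: "tact M (x - n *s y) = tact M x - n *s tact M y" for M :: "int^'n^'n" and x y n
    by (simp add: vec_eq_iff tact_nth sum_subtractf sum_distrib_left algebra_simps)
  have 2: "pairing x (y - n *s z) = pairing x y - n * pairing x z" for x y z :: "int^'n" and n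
    by (simp add: pairing_def sum_subtractf sum_distrib_left algebra_simps)
  show ?thesis
    unfolding act_srefl[of b c] unfolding act_def ev_def fst_conv snd_conv 1 2 rpairing_diff_scale_right
    by (simp add: algebra_simps)
qed

section \<open>Existence of simple descents\<close>

text \<open>The integers \<open>n = 2r\<close> and \<open>k = 2/r\<close> have product 4, so
  \<open>n\<close> is 1, 2 or 4; the values 1 and 4 would make one root twice the other, against
  reducedness.\<close>

lemma proportional_roots_eq:
  assumes a: "a \<in> Phi" and b: "b \<in> Phi" and r: "r > 0"
    and eq: "\<And>i. real_of_int (a $ i) = r * real_of_int (b $ i)"
  shows "r = 1"
proof -
  have pa: "real_of_int (pairing x a) = r * real_of_int (pairing x b)" for x
    by (simp add: pairing_def eq sum_distrib_left algebra_simps)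
  define n k where "n = pairing (cor b) a" and "k = pairing (cor a) b"
  have n: "real_of_int n = 2 * r" using pa[of "cor b"] pairing_cor[OF b] by (simp add: n_def)
  have k: "2 = r * real_of_int k" using pa[of "cor a"] pairing_cor[OF a] by (simp add: k_def)
  have "real_of_int (n * k) = 4" using n k by simp
  then have nk: "n * k = 4" by linarith
  have npos: "n > 0" using n r by linarith
  have "n dvd 4" using nk by (metis dvd_triv_left)
  then have "n \<le> 4" by (simp add: zdvd_imp_le)
  then consider "n = 1" | "n = 2" | "n = 3" | "n = 4" using npos by linarith
  then show ?thesis
  proof cases
    case 1
    then have "r = 1 / 2" using n by simp
    then have "real_of_int (b $ i) = real_of_int (2 * a $ i)" for i using eq[of i] by simp
    then have "b = 2 *s a" unfolding of_int_eq_iff by (simp add: vec_eq_iff)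
    then show ?thesis using a b reduced by (auto simp: reduced_rd_def)
  next
    case 2
    then show ?thesis using n by simp
  next
    case 3
    then show ?thesis using nk by presburger
  next
    case 4
    then have "r = 2" using n by simp
    then have "real_of_int (a $ i) = real_of_int (2 * b $ i)" for i using eq[of i] by simp
    then have "a = 2 *s b" unfolding of_int_eq_iff by (simp add: vec_eq_iff)
    then show ?thesis using a b reduced by (auto simp: reduced_rd_def)
  qed
qed

text \<open>Equality would mean that the segment from \<open>u\<close> to \<open>w v\<close> meets
  the hyperplanes of \<open>b\<close> and \<open>c\<close> simultaneously. A small perturbation of
  \<open>v\<close> avoids this for every pair, because \<open>L\<close> vanishes identically only if
  the gradients have the positive ratio \<open>q b / q c\<close>, which forces
  \<open>b = c\<close>.\<close>

lemma ex_generic_alcove_point: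
  assumes w: "w \<in> ext_weyl Phi cor Om" and v: "alcove_point v"
  shows "\<exists>u. alcove_point u \<and> (\<forall>b\<in>inversions w. \<forall>c\<in>inversions w. b \<noteq> c \<longrightarrow>
    ev u b * ev v (act w c) \<noteq> ev u c * ev v (act w b))"
proof -
  define q where "q b = ev v (act w b)" for b
  define I where "I = {(b, c) \<in> inversions w \<times> inversions w. b \<noteq> c}"
  define L where "L = (\<lambda>(b, c) u. rpairing u (fst b) * q c - rpairing u (fst c) * q b)"
  have fin: "finite I" using finite_inversions[OF w]
    by (intro finite_subset[of I "inversions w \<times> inversions w"]) (auto simp: I_def)
  have qneg: "q b < 0" if "b \<in> inversions w" for b
    using that apos_iff_ev(2)[OF v act_aff_roots[OF w, of b]] apos_subset
    by (auto simp: inversions_def q_def)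
  have "\<exists>u0. \<forall>i\<in>I. L i u0 \<noteq> 0"
  proof (rule ex_generic_vector[OF fin])
    fix i assume i: "i \<in> I"
    obtain b c where bc: "i = (b, c)" "b \<in> inversions w" "c \<in> inversions w" "b \<noteq> c"
      using i by (auto simp: I_def)
    show "linear (L i)"
      unfolding L_def bc prod.case
      by (rule linearI) (simp_all add: rpairing_add_left rpairing_scaleR_left algebra_simps)
    show "\<exists>u. L i u \<noteq> 0"
    proof (rule ccontr)
      assume "\<nexists>u. L i u \<noteq> 0"
      then have z: "rpairing u (fst b) * q c = rpairing u (fst c) * q b" for u
        by (auto simp: L_def bc)
      \<comment> \<open>Testing on the coordinate vectors recovers the entries of the
        gradients.\<close>
      have "real_of_int (fst b $ j) = q b / q c * real_of_int (fst c $ j)" for j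
        using z[of "axis j 1"] qneg[OF bc(3)] by (simp add: rpairing_axis field_simps)
      moreover have P: "fst b \<in> Phi" "fst c \<in> Phi" using bc apos_subset by (auto simp: inversions_def)
      ultimately have 1: "q b / q c = 1"
        by (rule proportional_roots_eq[rotated 3]) (use qneg bc in \<open>simp add: divide_neg_neg\<close>)
      then have "q b = q c" using qneg[OF bc(3)] by simp
      moreover have fb: "fst b = fst c"
        using \<open>\<And>j. real_of_int (fst b $ j) = q b / q c * real_of_int (fst c $ j)\<close> 1 by (simp add: vec_eq_iff)
      ultimately have "snd b = snd c" by (simp add: q_def ev_def act_def)
      then show False using fb bc by (simp add: prod_eq_iff)
    qed
  qed
  then obtain u0 where u0: "\<And>i. i \<in> I \<Longrightarrow> L i u0 \<noteq> 0" by blast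
  have "eventually (\<lambda>e. 0 < rpairing (v + e *\<^sub>R u0) a \<and> rpairing (v + e *\<^sub>R u0) a < 1) (at_right 0)"
    if "a \<in> pos" for a
  proof -
    have "((\<lambda>e. rpairing (v + e *\<^sub>R u0) a) \<longlongrightarrow> rpairing v a + 0 * rpairing u0 a) (at_right 0)"
      unfolding rpairing_add_left rpairing_scaleR_left by (intro tendsto_intros)
    then show ?thesis using v that by (intro eventually_conj order_tendstoD) auto
  qed
  then have ev1: "eventually (\<lambda>e. alcove_point (v + e *\<^sub>R u0)) (at_right 0)"
    using finite_pos by (intro eventually_ball_finite) auto
  have "eventually (\<lambda>e. ev (v + e *\<^sub>R u0) (fst i) * q (snd i) \<noteq> ev (v + e *\<^sub>R u0) (snd i) * q (fst i)) (at_right 0)"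
    if "i \<in> I" for i
  proof -
    \<comment> \<open>The difference is affine in \<open>e\<close> with nonzero slope, so it is
      nonzero for small positive \<open>e\<close>.\<close>
    have eq: "ev (v + e *\<^sub>R u0) (fst i) * q (snd i) - ev (v + e *\<^sub>R u0) (snd i) * q (fst i)
      = (ev v (fst i) * q (snd i) - ev v (snd i) * q (fst i)) + e * L i u0" for e
      by (simp add: L_def ev_def rpairing_add_left rpairing_scaleR_left case_prod_unfold algebra_simps)
    show ?thesis
    proof (rule eventually_mono[OF eventually_at_right_affine_nonzero[OF u0[OF that]]])
      fix e assume "(ev v (fst i) * q (snd i) - ev v (snd i) * q (fst i)) + e * L i u0 \<noteq> 0"
      then show "ev (v + e *\<^sub>R u0) (fst i) * q (snd i) \<noteq> ev (v + e *\<^sub>R u0) (snd i) * q (fst i)"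
        unfolding eq[symmetric] right_minus_eq .
    qed
  qed
  then have "eventually (\<lambda>e. \<forall>i\<in>I. ev (v + e *\<^sub>R u0) (fst i) * q (snd i) \<noteq> ev (v + e *\<^sub>R u0) (snd i) * q (fst i))
      (at_right 0)"
    using fin by (intro eventually_ball_finite) auto
  with ev1 have "eventually (\<lambda>e. alcove_point (v + e *\<^sub>R u0) \<and>
     (\<forall>i\<in>I. ev (v + e *\<^sub>R u0) (fst i) * q (snd i) \<noteq> ev (v + e *\<^sub>R u0) (snd i) * q (fst i))) (at_right 0)"
    by (rule eventually_conj)
  then obtain e where e: "alcove_point (v + e *\<^sub>R u0)" 
    "\<And>i. i \<in> I \<Longrightarrow> ev (v + e *\<^sub>R u0) (fst i) * q (snd i) \<noteq> ev (v + e *\<^sub>R u0) (snd i) * q (fst i)"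
    using eventually_happens'[OF trivial_limit_at_right_real] by fastforce
  have "ev (v + e *\<^sub>R u0) b * ev v (act w c) \<noteq> ev (v + e *\<^sub>R u0) c * ev v (act w b)"
    if "b \<in> inversions w" "c \<in> inversions w" "b \<noteq> c" for b c
    using e(2)[of "(b, c)"] that unfolding I_def q_def by simp
  then show ?thesis using e(1) by blast
qed

text \<open>On a generic segment from the fundamental alcove to its image under \<open>w\<close>, the first hyperplane
  that is crossed is a wall of the fundamental alcove.\<close>

lemma ex_simple_inversion:
  assumes w: "w \<in> ext_weyl Phi cor Om" and ne: "inversions w \<noteq> {}"
  shows "\<exists>b\<in>simple. b \<in> inversions w"
proof -
  obtain v where v: "alcove_point v" using ex_alcove_point by blast
  obtain u where u: "alcove_point u" and gen: "\<And>b c. \<lbrakk>b \<in> inversions w; c \<in> inversions w; b \<noteq> c\<rbrakk> \<Longrightarrow>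
    ev u b * ev v (act w c) \<noteq> ev u c * ev v (act w b)"
    using ex_generic_alcove_point[OF w v] by blast
  define q where "q b = ev v (act w b)" for b
  \<comment> \<open>The time at which the segment from \<open>u\<close> to \<open>w v\<close> meets
    the hyperplane of \<open>b\<close>.\<close>
  define tm where "tm b = ev u b / (ev u b - q b)" for b
  have up: "ev u b > 0" if "b \<in> apos" for b
    using that apos_iff_ev(1)[OF u] apos_subset by blast
  have qn: "q b < 0" if "b \<in> inversions w" for b
    using that apos_iff_ev(2)[OF v act_aff_roots[OF w, of b]] apos_subset
    by (auto simp: inversions_def q_def)
  have qp: "q b > 0" if "b \<in> apos" "b \<notin> inversions w" for b
    using that apos_iff_ev(1)[OF v act_aff_roots[OF w, of b]] apos_subset
    by (auto simp: inversions_def q_def)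
  have ia: "b \<in> apos" if "b \<in> inversions w" for b using that by (simp add: inversions_def)
  obtain b where b: "b \<in> inversions w" and bmin: "\<And>c. c \<in> inversions w \<Longrightarrow> tm b \<le> tm c"
    using arg_min_if_finite[OF finite_inversions[OF w] ne, of tm] by (meson not_le_imp_less)
  define t where "t = tm b"
  have den: "ev u c - q c > 0" if "c \<in> inversions w" for c using up[OF ia[OF that]] qn[OF that] by simp
  have t: "0 < t" "t < 1"
    using den[OF b] up[OF ia[OF b]] qn[OF b] by (auto simp: t_def tm_def field_simps)
  \<comment> \<open>The value of \<open>c\<close> at the first crossing point. It will vanish at
    \<open>b\<close> and be positive on all other positive affine roots.\<close>
  define E where "E c = (1 - t) * ev u c + t * q c" for c
  have E_alt: "E c = (tm c - t) * (ev u c - q c)" if "c \<in> inversions w" for c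
    using den[OF that] by (simp add: E_def tm_def field_simps)
  have Eb: "E b = 0" using E_alt[OF b] by (simp add: t_def)
  have Epos: "E c > 0" if c: "c \<in> apos" "c \<noteq> b" for c
  proof (cases "c \<in> inversions w")
    case True
    have "tm c \<noteq> t"
    proof
      assume "tm c = t"
      then have "ev u c * (ev u b - q b) = ev u b * (ev u c - q c)"
        using den[OF True] den[OF b] by (simp add: t_def tm_def field_simps)
      then have "ev u b * q c = ev u c * q b" by (simp add: algebra_simps)
      then show False using gen[OF b True] c by (simp add: q_def)
    qed
    then have "tm c > t" using bmin[OF True] by (simp add: t_def)
    then show ?thesis using E_alt[OF True] den[OF True] by simp
  next
    case False
    then show ?thesis using up[OF c(1)] qp[OF c(1) False] t by (simp add: E_def add_pos_pos)
  qed
  have bA: "b \<in> aff_roots" using ia[OF b] apos_subset by blast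
  have s: "srefl b \<in> ext_weyl Phi cor Om" using bA by (rule srefl_ext_weyl)
  \<comment> \<open>The crossing point lies on the hyperplane of \<open>b\<close>, so the reflection
    fixes it.\<close>
  have Es: "E (act (srefl b) c) = E c" for c
  proof -
    let ?n = "real_of_int (pairing (cor (fst b)) (fst c))"
    have 1: "ev u (act (srefl b) c) = ev u c - ?n * ev u b"
      using ev_act_srefl[of u ew_one b c] by simp
    have 2: "q (act (srefl b) c) = q c - ?n * q b"
      unfolding q_def by (rule ev_act_srefl)
    have "E (act (srefl b) c) = E c - ?n * E b"
      unfolding E_def 1 2 by (simp add: algebra_simps)
    then show ?thesis using Eb by simp
  qed
  have Eneg: "E (neg c) = - E c" for c
    by (simp add: E_def q_def act_neg) (simp add: neg_def ev_def rpairing_minus_right algebra_simps)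
  have "inversions (srefl b) = {b}"
  proof (intro equalityI subsetI)
    fix c assume c: "c \<in> inversions (srefl b)"
    show "c \<in> {b}"
    proof (rule ccontr)
      \<comment> \<open>If \<open>c\<close> were another inversion, the negative of its reflection
        would be a positive affine root with value \<open>- E c < 0\<close>, although
        \<open>E\<close> is nonnegative on \<open>apos\<close>.\<close>
      assume cb: "c \<notin> {b}"
      have c1: "c \<in> apos" "act (srefl b) c \<notin> apos" using c by (auto simp: inversions_def)
      have "act (srefl b) c \<in> aff_roots" using act_aff_roots[OF s] c1 apos_subset by blast
      from neg_apos[OF this] c1(2) have n: "neg (act (srefl b) c) \<in> apos" by simp
      have Ec: "E c > 0" using Epos c1 cb by simp
      have En: "E (neg (act (srefl b) c)) = - E c" by (simp add: Eneg Es)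
      then have "neg (act (srefl b) c) \<noteq> b" using Eb Ec by auto
      then have "E (neg (act (srefl b) c)) > 0" by (rule Epos[OF n])
      then show False using En Ec by simp
    qed
  next
    fix c assume "c \<in> {b}"
    then show "c \<in> inversions (srefl b)"
      using ia[OF b] neg_apos[OF bA] act_srefl_self[OF bA] by (simp add: inversions_def)
  qed
  then show ?thesis using b bA by (auto simp: simple_def)
qed

section \<open>Powers that act trivially on the roots\<close>

lemma act_pow:
  fixes n :: nat
  assumes "g \<in> ext_weyl Phi cor Om"
  shows "act (g [^]\<^bsub>ewG\<^esub> n) = act g ^^ n"
proof -
  interpret group ewG by (rule group_ewG)
  have "act (g [^]\<^bsub>ewG\<^esub> n) b = (act g ^^ n) b" for b
    by (induction n arbitrary: b) (simp_all add: act_ew_mult)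
  then show ?thesis by blast
qed

lemma ex_pow_trivial_on_Phi:
  assumes g: "g \<in> ext_weyl Phi cor Om"
  shows "\<exists>n>0. \<forall>a\<in>Phi. tact (snd (g [^]\<^bsub>ewG\<^esub> (n::nat))) a = a"
proof -
  interpret group ewG by (rule group_ewG)
  have surj: "Phi \<subseteq> tact (snd g) ` Phi"
  proof
    fix a assume "a \<in> Phi"
    then have "(a, 0) \<in> act g ` aff_roots" using act_bij[OF g] by (auto simp: bij_betw_def)
    then show "a \<in> tact (snd g) ` Phi" by (auto simp: act_def)
  qed
  have im: "tact (snd g) ` Phi = Phi" using surj tact_Phi[OF g] by blast
  have inj: "inj_on (tact (snd g)) Phi"
    using im finite_Phi by (intro eq_card_imp_inj_on) auto
  \<comment> \<open>Extended by the identity, the action of \<open>g\<close> on the finite set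
    \<open>Phi\<close> is a permutation and has finite order.\<close>
  define p where "p a = (if a \<in> Phi then tact (snd g) a else a)" for a
  have "p permutes Phi"
    by (rule bij_imp_permutes) (use im inj in \<open>auto simp: p_def bij_betw_def inj_on_def image_def\<close>)
  then have "permutation p" using finite_Phi permutation_permutes by blast
  then obtain n where n: "p ^^ n = id" "n > 0"
    by (rule permutation_is_nilpotent)
  have "tact (snd (g [^]\<^bsub>ewG\<^esub> k)) a = (p ^^ k) a \<and> (p ^^ k) a \<in> Phi" if "a \<in> Phi" for a and k :: nat
    using that tact_Phi[OF g] by (induction k) (auto simp: ew_one_def ew_mult_def tact_mult p_def)
  then show ?thesis using n by (intro exI[of _ n]) auto
qed

text \<open>For nonzero \<open>n\<close> the bound prevents \<open>j n + c\<close> from having the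
  sign opposite to \<open>n\<close>, so the absolute values add.\<close>

lemma abs_shift_additive:
  fixes n c :: int
  assumes "\<bar>c\<bar> \<le> int j"
  shows "\<bar>(int j + 1) * n + c\<bar> = \<bar>n\<bar> + \<bar>int j * n + c\<bar>"
  unfolding distrib_right mult_1
proof (cases n "0::int" rule: linorder_cases)
  case less
  then have "int j * n \<le> int j * (- 1)" by (intro mult_left_mono) auto
  then show "\<bar>int j * n + n + c\<bar> = \<bar>n\<bar> + \<bar>int j * n + c\<bar>" using less assms by linarith
next
  case greater
  then have "int j * 1 \<le> int j * n" by (intro mult_left_mono) auto
  then show "\<bar>int j * n + n + c\<bar> = \<bar>n\<bar> + \<bar>int j * n + c\<bar>" using greater assms by linarith
qed simp

text \<open>A power \<open>h\<close> of \<open>g\<close> that fixes all roots only translates the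
  constants of affine roots. Each \<open>shift\<close> of \<open>h^j x\<close> is therefore affine
  in \<open>j\<close> with slope \<open><fst h, a>\<close>, and for large \<open>j\<close> all
  absolute values grow linearly.\<close>

lemma ex_straight:
  assumes x: "x \<in> ext_weyl Phi cor Om" and g: "g \<in> ext_weyl Phi cor Om"
  shows "\<exists>n>0. \<exists>j. ew_len pos (ew_mult (g [^]\<^bsub>ewG\<^esub> (n::nat)) (ew_mult ((g [^]\<^bsub>ewG\<^esub> n) [^]\<^bsub>ewG\<^esub> (j::nat)) x))
    = ew_len pos (g [^]\<^bsub>ewG\<^esub> n) + ew_len pos (ew_mult ((g [^]\<^bsub>ewG\<^esub> n) [^]\<^bsub>ewG\<^esub> j) x)"
proof -
  interpret group ewG by (rule group_ewG)
  obtain n where n: "n > (0::nat)" "\<forall>a\<in>Phi. tact (snd (g [^]\<^bsub>ewG\<^esub> n)) a = a"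
    using ex_pow_trivial_on_Phi[OF g] by blast
  define h where "h = g [^]\<^bsub>ewG\<^esub> n"
  have h: "h \<in> ext_weyl Phi cor Om" using nat_pow_closed[of g n] g by (simp add: h_def)
  have act_h: "act h (a, k) = (a, k + pairing (fst h) a)" if "a \<in> Phi" for a k
    using n that by (simp add: act_def h_def)
  have act_hj: "act (h [^]\<^bsub>ewG\<^esub> j) (a, k) = (a, k + int j * pairing (fst h) a)" if "a \<in> Phi" for a k and j :: nat
    unfolding act_pow[OF h] by (induction j) (simp_all add: act_h that algebra_simps)
  have shift_act: "shift w a = snd (act w (a, 0)) - (if fst (act w (a, 0)) \<in> pos then 0 else 1)" for w a
    by (simp add: shift_def act_def)
  have shift_h: "shift h a = pairing (fst h) a" if "a \<in> pos" for a
    using that pos_subset by (auto simp: shift_act act_h)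
  have act_shift: "act x (a, k) = (fst (act x (a, 0)), k + snd (act x (a, 0)))" for a k
    by (simp add: act_def)
  have shift_hj: "shift (ew_mult (h [^]\<^bsub>ewG\<^esub> j) x) a = int j * pairing (fst h) a + shift x a"
    if "a \<in> pos" for a and j :: nat
    using that pos_subset act_hj[of a j 0] act_shift[of a "int j * pairing (fst h) a"]
    by (auto simp: shift_act act_ew_mult)
  \<comment> \<open>A crude common bound for all \<open>|shift x a|\<close>, as
    \<open>abs_shift_additive\<close> requires.\<close>
  define j where "j = (\<Sum>a\<in>pos. nat \<bar>shift x a\<bar>)"
  have j: "\<bar>shift x a\<bar> \<le> int j" if "a \<in> pos" for a
  proof -
    have "nat \<bar>shift x a\<bar> \<le> j"
      unfolding j_def using finite_pos that by (intro member_le_sum) auto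
    then show ?thesis by linarith
  qed
  have Suc: "ew_mult h (ew_mult (h [^]\<^bsub>ewG\<^esub> j) x) = ew_mult (h [^]\<^bsub>ewG\<^esub> Suc j) x"
    using nat_pow_Suc2[of h j] h by (simp add: ew_mult_assoc)
  have "nat \<bar>shift (ew_mult (h [^]\<^bsub>ewG\<^esub> Suc j) x) a\<bar>
      = nat \<bar>shift h a\<bar> + nat \<bar>shift (ew_mult (h [^]\<^bsub>ewG\<^esub> j) x) a\<bar>" if "a \<in> pos" for a
    unfolding shift_hj[OF that] shift_h[OF that]
    using abs_shift_additive[OF j[OF that], of "pairing (fst h) a"]
    by (simp add: nat_add_distrib add.commute)
  then have "ew_len pos (ew_mult h (ew_mult (h [^]\<^bsub>ewG\<^esub> j) x)) = ew_len pos h + ew_len pos (ew_mult (h [^]\<^bsub>ewG\<^esub> j) x)"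
    unfolding Suc ew_len_eq_sum_shift by (simp add: sum.distrib)
  then show ?thesis using n unfolding h_def by blast
qed

end

section \<open>The extended affine Weyl group as an instance of the abstract setting\<close>

theorem theorem6p8:
  fixes Phi :: "(int^'n) set" and cor :: "int^'n \<Rightarrow> int^'n"
    and pos :: "(int^'n) set" and Om :: "(int^'n^'n) set"
    and m :: "('n ewg \<Rightarrow>\<^sub>0 lpoly) \<Rightarrow> ('n ewg \<Rightarrow>\<^sub>0 lpoly) \<Rightarrow> ('n ewg \<Rightarrow>\<^sub>0 lpoly)"
    and r :: nat and w :: "nat \<Rightarrow> 'n ewg"
  assumes "root_datum Phi cor" and "reduced_rd Phi"
    and "positive_system Phi pos"
    and "diagram_group Phi cor pos Om"
    and "is_hecke_mult (ext_weyl Phi cor Om) ew_mult ew_one (ew_len pos)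
           (simple_refls Phi cor pos) m"
    and "\<forall>i<r. w i \<in> ext_weyl Phi cor Om"
    and "\<forall>i<r. \<forall>j<r. i \<noteq> j \<longrightarrow> \<not> conj_in (ext_weyl Phi cor Om) (w i) (w j)"
  shows "\<forall>c :: nat \<Rightarrow> lpoly.
           (\<Sum>i<r. hsmult (c i) (Tb (w i))) \<in> comm_span (ext_weyl Phi cor Om) m
           \<longrightarrow> (\<forall>i<r. c i = 0)"
proof (intro allI impI)
  interpret based_root_datum Phi cor pos Om
    by unfold_locales fact+
  let ?G = "ext_weyl Phi cor Om"
  note hecke = assms(5)[unfolded is_hecke_mult_def]
  have simple_aff: "b \<in> aff_roots" if "b \<in> simple" for b
    using that by (simp add: simple_def)
  \<comment> \<open>Reflections in simple affine roots serve as \<open>S\<close>: they are elements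
    of length one in the affine Weyl group, so the quadratic relation holds for them, and
    \<open>ex_simple_inversion\<close> supplies the descents.\<close>
  interpret hecke_length ewG m "ew_len pos" "srefl ` simple"
  proof (intro hecke_length.intro bilinear_mult.intro group_ewG bilinear_mult_axioms.intro
      hecke_length_axioms.intro, unfold ewG_simps)
    show "ew_len pos ew_one = 0"
    proof -
      have "ew_one \<in> ?G" using monoid.one_closed[OF group.is_monoid[OF group_ewG]] by simp
      then show ?thesis using ew_len_eq_card[of ew_one] by (simp add: inversions_def)
    qed
  next
    fix s assume "s \<in> srefl ` simple"
    then obtain b where b: "s = srefl b" "b \<in> simple" by blast
    show "s \<in> ?G" using b srefl_ext_weyl simple_aff by blast
    show "ew_mult s s = ew_one" using b srefl_square simple_aff by blast
    show "ew_len pos s = 1" using b ew_len_srefl by blast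
    show "ew_len pos (ew_mult s x) = Suc (ew_len pos x) \<or> ew_len pos x = Suc (ew_len pos (ew_mult s x))"
      if "x \<in> ?G" for x
      using ew_len_srefl_mult[OF b(2) that] unfolding b(1) by (metis (full_types))
    show "m (Tb s - hsmult lv (Tb ew_one)) (Tb s + hsmult lvinv (Tb ew_one)) = 0"
      using hecke b srefl_simple_refls by blast
  next
    fix x assume x: "x \<in> ?G" "0 < ew_len pos x"
    then have "inversions x \<noteq> {}" using ew_len_eq_card[OF x(1)] by auto
    then obtain b where b: "b \<in> simple" "b \<in> inversions x" using ex_simple_inversion[OF x(1)] by blast
    then show "\<exists>s\<in>srefl ` simple. ew_len pos x = Suc (ew_len pos (ew_mult s x))"
      using ew_len_srefl_mult[OF b(1) x(1)] by auto
  next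
    fix x y assume "x \<in> ?G" "y \<in> ?G" "ew_len pos x = 0"
    then show "ew_len pos (ew_mult x y) = ew_len pos y" by (rule ew_len_zero_mult)
  next
    fix x g assume "x \<in> ?G" "g \<in> ?G"
    then show "\<exists>n>0. \<exists>j. ew_len pos (ew_mult (g [^]\<^bsub>ewG\<^esub> (n::nat)) (ew_mult ((g [^]\<^bsub>ewG\<^esub> n) [^]\<^bsub>ewG\<^esub> (j::nat)) x))
      = ew_len pos (g [^]\<^bsub>ewG\<^esub> n) + ew_len pos (ew_mult ((g [^]\<^bsub>ewG\<^esub> n) [^]\<^bsub>ewG\<^esub> j) x)"
      by (rule ex_straight)
  qed (use hecke in blast)+
  fix c :: "nat \<Rightarrow> lpoly" and i
  assume "(\<Sum>i<r. hsmult (c i) (Tb (w i))) \<in> comm_span ?G m" "i < r"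
  then show "c i = 0"
    using assms(6,7) by (intro linear_independent_mod_comm_span[of r w c i]) (auto simp: conj_in_def)
qed

end
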